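(* For every real $r>10/3$ there is a constant $C_r>0$, depending only on $r$, such that for every prime $p$ for which $-1$ is not a square in $\mathbb F_p$ and every function $f:\mathcal P\to\mathbb C$ on the paraboloid $\mathcal P=\{(v,v\cdot v):v\in\mathbb F_p^2\}\subset\mathbb F_p^3$, $$\|(f\,d\sigma)^\vee\|_{L^r(\mathbb F_p^3)}\le C_r\,\|f\|_{L^2(\mathcal P,d\sigma)}.$$
   Context: Here $\cdot$ is the usual dot product, and $d\sigma$ is the measure on $\mathcal P$ assigning mass $p^{-2}$ to each of its points. For $s\in\mathbb F_p$, $e_p(s):=\exp(2\pi i s/p)$, using any integer representative of $s$. The extension operator is $(f\,d\sigma)^\vee(x):=p^{-2}\sum_{\xi\in\mathcal P}f(\xi)e_p(x\cdot\xi)$ for $x\in\mathbb F_p^3$. Norms on $\mathbb F_p^3$ are with respect to counting measure and norms on $\mathcal P$ are with respect to $d\sigma$, i.e. $\|g\|_{L^r(\mathbb F_p^3)}=(\sum_{x\in\mathbb F_p^3}|g(x)|^r)^{1/r}$ and $\|f\|_{L^2(\mathcal P,d\sigma)}=(p^{-2}\sum_{\xi\in\mathcal P}|f(\xi)|^2)^{1/2}$. *)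

theory Defs
  imports Complex_Main "HOL-Number_Theory.Residues"
begin

text \<open>
  The field with \<open>p\<close> elements is \<open>residue_ring (int p)\<close>, with carrier \<open>{0..int p - 1}\<close> and the
  operations reduced modulo \<open>p\<close>. The prime is a term variable, not a type, so that a constant
  can be chosen before \<open>p\<close>.
\<close>

abbreviation Fp :: "nat \<Rightarrow> int ring" where
  "Fp p \<equiv> residue_ring (int p)"

definition Fp3 :: "nat \<Rightarrow> (int \<times> int \<times> int) set" where
  "Fp3 p = carrier (Fp p) \<times> carrier (Fp p) \<times> carrier (Fp p)"

fun dot2 :: "nat \<Rightarrow> int \<times> int \<Rightarrow> int \<times> int \<Rightarrow> int" where
  "dot2 p (a, b) (c, d) = (a \<otimes>\<^bsub>Fp p\<^esub> c) \<oplus>\<^bsub>Fp p\<^esub> (b \<otimes>\<^bsub>Fp p\<^esub> d)"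

fun dot3 :: "nat \<Rightarrow> int \<times> int \<times> int \<Rightarrow> int \<times> int \<times> int \<Rightarrow> int" where
  "dot3 p (a, b, c) (u, v, w) =
     ((a \<otimes>\<^bsub>Fp p\<^esub> u) \<oplus>\<^bsub>Fp p\<^esub> (b \<otimes>\<^bsub>Fp p\<^esub> v)) \<oplus>\<^bsub>Fp p\<^esub> (c \<otimes>\<^bsub>Fp p\<^esub> w)"

definition paraboloid :: "nat \<Rightarrow> (int \<times> int \<times> int) set" where
  "paraboloid p =
     {(a, b, dot2 p (a, b) (a, b)) | a b. a \<in> carrier (Fp p) \<and> b \<in> carrier (Fp p)}"

definition e_char :: "nat \<Rightarrow> int \<Rightarrow> complex" where
  "e_char p s = exp (2 * of_real pi * \<i> * of_int s / of_nat p)"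

text \<open>
  Functions on the paraboloid are total functions of which only the values on \<open>paraboloid p\<close>
  are used.
\<close>

definition extension :: "nat \<Rightarrow> (int \<times> int \<times> int \<Rightarrow> complex) \<Rightarrow> int \<times> int \<times> int \<Rightarrow> complex" where
  "extension p f x = (\<Sum>\<xi>\<in>paraboloid p. f \<xi> * e_char p (dot3 p x \<xi>)) / of_nat p ^ 2"

definition norm_Fp3 :: "nat \<Rightarrow> real \<Rightarrow> (int \<times> int \<times> int \<Rightarrow> complex) \<Rightarrow> real" where
  "norm_Fp3 p r g = (\<Sum>x\<in>Fp3 p. norm (g x) powr r) powr (1 / r)"

definition norm_L2_paraboloid :: "nat \<Rightarrow> (int \<times> int \<times> int \<Rightarrow> complex) \<Rightarrow> real" where
  "norm_L2_paraboloid p f = sqrt ((\<Sum>\<xi>\<in>paraboloid p. (norm (f \<xi>))\<^sup>2) / real p ^ 2)"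

end

theory Submission
  imports Defs "HOL-Analysis.Analysis" "HOL-Library.Product_Plus"
begin

text \<open>
  By duality, the level set \<open>|(f d\<sigma>)\<^sup>\<or>| \<ge> \<delta>\<close> of size \<open>N\<close> is controlled by the \<open>L\<^sup>2\<close> norm on the paraboloid of
  the Fourier transform of a unimodular function \<open>g\<close> on that set, hence by the \<open>L\<^sup>4\<close> norm of
  \<open>\<Sum>\<^sub>z U z\<close>, where \<open>U z\<close> is the Schroedinger solution whose datum at time \<open>z\<close> is the slice of \<open>g\<close> at
  height \<open>z\<close>. Instead of treating the slices one at a time (which would need sharp bounds for the
  number of rectangles in a plane set), Cauchy-Schwarz reduces to the \<open>L\<^sup>2\<close> norm of the joint density
  \<open>\<Sum>\<^sub>z |U z|\<^sup>2 / h z\<close> with \<open>h z\<close> the size of the slice. Its Fourier modes in a direction \<open>a\<close> form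
  the entries of a positive \<open>p \<times> p\<close> matrix, a sum of rank-one terms over the lines in direction \<open>a\<close>.
  Bounding each such term by a diagonal matrix at its own time, and using that a sum over all times of
  a one-dimensional density recovers the Hilbert-Schmidt norm of the same matrix, gives a
  self-improving inequality for that norm; what remains is a count of the pairs of slice points in
  direction \<open>a\<close>, trivial on average over \<open>a\<close>. The result, together with Plancherel and the Gauss sum
  decay of \<open>(d\<sigma>)\<^sup>\<or>\<close>, is \<open>N\<^sup>3 \<delta>\<^sup>1\<^sup>0 \<le> 14 \<parallel>f\<parallel>\<^sup>1\<^sup>0\<close>, the weak-type bound at \<open>10/3\<close>.
\<close>

section \<open>Finite Parseval identities and elementary facts on sums\<close>

lemma sum_parseval:
  fixes E :: "'x \<Rightarrow> 'i \<Rightarrow> complex"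
  assumes "finite I"
    and orth: "\<And>i j. i \<in> I \<Longrightarrow> j \<in> I \<Longrightarrow> (\<Sum>x\<in>X. E x i * cnj (E x j)) = (if i = j then P else 0)"
  shows "(\<Sum>x\<in>X. (\<Sum>i\<in>I. c i * E x i) * cnj (\<Sum>i\<in>I. d i * E x i)) = P * (\<Sum>i\<in>I. c i * cnj (d i))"
proof -
  have "(\<Sum>x\<in>X. (\<Sum>i\<in>I. c i * E x i) * cnj (\<Sum>i\<in>I. d i * E x i))
      = (\<Sum>x\<in>X. \<Sum>i\<in>I. \<Sum>j\<in>I. c i * cnj (d j) * (E x i * cnj (E x j)))"
    by (simp add: sum_product mult_ac)
  also have "\<dots> = (\<Sum>i\<in>I. \<Sum>x\<in>X. \<Sum>j\<in>I. c i * cnj (d j) * (E x i * cnj (E x j)))"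
    by (rule sum.swap)
  also have "\<dots> = (\<Sum>i\<in>I. \<Sum>j\<in>I. \<Sum>x\<in>X. c i * cnj (d j) * (E x i * cnj (E x j)))"
    by (intro sum.cong refl sum.swap)
  also have "\<dots> = (\<Sum>i\<in>I. \<Sum>j\<in>I. c i * cnj (d j) * (if i = j then P else 0))"
    by (intro sum.cong refl) (simp add: sum_distrib_left [symmetric] orth)
  also have "\<dots> = (\<Sum>i\<in>I. P * (c i * cnj (d i)))"
    using \<open>finite I\<close> by (intro sum.cong refl) (simp add: if_distrib cong: if_cong)
  finally show ?thesis
    by (simp add: sum_distrib_left)
qed

lemma sum_norm_parseval:
  fixes E :: "'x \<Rightarrow> 'i \<Rightarrow> complex" and P :: real
  assumes "finite I"
    and orth: "\<And>i j. i \<in> I \<Longrightarrow> j \<in> I \<Longrightarrow> (\<Sum>x\<in>X. E x i * cnj (E x j)) = (if i = j then of_real P else 0)"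
  shows "(\<Sum>x\<in>X. (norm (\<Sum>i\<in>I. c i * E x i))\<^sup>2) = P * (\<Sum>i\<in>I. (norm (c i))\<^sup>2)"
proof -
  have "complex_of_real (\<Sum>x\<in>X. (norm (\<Sum>i\<in>I. c i * E x i))\<^sup>2) =
      (\<Sum>x\<in>X. (\<Sum>i\<in>I. c i * E x i) * cnj (\<Sum>i\<in>I. c i * E x i))"
    by (simp only: of_real_sum complex_norm_square)
  also have "\<dots> = of_real P * (\<Sum>i\<in>I. c i * cnj (c i))"
    by (rule sum_parseval) (use assms in auto)
  also have "\<dots> = of_real (P * (\<Sum>i\<in>I. (norm (c i))\<^sup>2))"
    by (simp only: of_real_sum of_real_mult complex_norm_square)
  finally show ?thesis
    by (simp only: of_real_eq_iff)
qed

lemma norm_sum_squared_le: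
  fixes z :: "'a \<Rightarrow> 'b::real_normed_vector"
  shows "(norm (\<Sum>i\<in>I. z i))\<^sup>2 \<le> card I * (\<Sum>i\<in>I. (norm (z i))\<^sup>2)"
proof -
  have "(norm (\<Sum>i\<in>I. z i))\<^sup>2 \<le> (\<Sum>i\<in>I. norm (z i))\<^sup>2"
    by (intro power_mono norm_sum) auto
  also have "\<dots> \<le> card I * (\<Sum>i\<in>I. (norm (z i))\<^sup>2)"
    using sum_squared_le_sum_of_squares [of "\<lambda>i. norm (z i)" I] by (simp add: mult.commute)
  finally show ?thesis .
qed

lemma sum_reindex_endo:
  fixes f :: "'a \<Rightarrow> 'b::comm_monoid_add"
  assumes "finite S" "\<And>u. u \<in> S \<Longrightarrow> h u \<in> S" "inj_on h S"
  shows "(\<Sum>u\<in>S. f (h u)) = (\<Sum>u\<in>S. f u)"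
proof -
  have "h ` S = S"
    using assms by (intro endo_inj_surj) auto
  with sum.reindex [OF assms(3), of f] show ?thesis
    by simp
qed

section \<open>Arithmetic and additive characters modulo \<open>p\<close>\<close>

locale odd_paraboloid =
  fixes p :: nat
  assumes prime_p: "prime p" and aniso: "\<not> QuadRes (int p) (- 1)"
begin

abbreviation R :: "int set" where "R \<equiv> {0..<int p}"

abbreviation e :: "int \<Rightarrow> complex" where "e \<equiv> e_char p"

lemma p_pos [simp]: "p > 0"
  using prime_p prime_gt_0_nat by blast

lemma prime_int_p: "prime (int p)"
  using prime_p by simp

text \<open>Modulo \<open>2\<close>, \<open>-1\<close> is the square of \<open>1\<close>, so the
  hypothesis on \<open>-1\<close> excludes \<open>p = 2\<close>.\<close>

lemma odd_p: "odd p"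
proof
  assume "even p"
  then have "p = 2"
    using prime_p primes_dvd_imp_eq two_is_prime_nat by blast
  then have "[1\<^sup>2 = -1] (mod int p)"
    by (simp add: cong_iff_dvd_diff)
  with aniso show False
    unfolding QuadRes_def by blast
qed

lemma p_ge_3: "p \<ge> 3"
proof -
  have "p \<noteq> 2" using odd_p by auto
  with prime_ge_2_nat [OF prime_p] show ?thesis by simp
qed

lemma two_dvd_cancel: "int p dvd 2 * x \<longleftrightarrow> int p dvd x"
proof -
  have "\<not> int p dvd 2"
    using p_ge_3 zdvd_imp_le by force
  then show ?thesis
    using prime_dvd_mult_iff [OF prime_int_p] by blast
qed

text \<open>If \<open>b\<close> were a unit, dividing by its square would exhibit \<open>-1\<close>
  as the square of \<open>a / b\<close>. This anisotropy of the sum of two squares is what makes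
  every nonzero direction usable later.\<close>

lemma sum_squares_dvd:
  assumes "int p dvd a * a + b * b"
  shows "int p dvd a \<and> int p dvd b"
proof -
  have *: "int p dvd b" if d: "int p dvd a * a + b * b" for a b :: int
  proof (rule ccontr)
    assume nb: "\<not> int p dvd b"
    then have "coprime b (int p)"
      using prime_imp_coprime [OF prime_int_p] coprime_commute by blast
    then obtain c where c: "[b * c = 1] (mod int p)"
      using cong_solve_coprime_int by blast
    have "[(a * a + b * b) * (c * c) = 0] (mod int p)"
      using d by (simp add: cong_0_iff)
    moreover have "(a * a + b * b) * (c * c) = (a * c)\<^sup>2 + (b * c) * (b * c)"
      by (simp add: power2_eq_square algebra_simps)
    moreover have "[(a * c)\<^sup>2 + (b * c) * (b * c) = (a * c)\<^sup>2 + 1 * 1] (mod int p)"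
      using c by (intro cong_add cong_mult cong_refl)
    ultimately have "[(a * c)\<^sup>2 + 1 = 0] (mod int p)"
      by (metis cong_sym cong_trans mult_1)
    then have "[(a * c)\<^sup>2 = -1] (mod int p)"
      by (simp add: cong_iff_dvd_diff)
    with aniso show False
      unfolding QuadRes_def by blast
  qed
  show ?thesis
    using *[of a b] *[of b a] assms by (simp add: add.commute)
qed

lemma R_eqI: "\<lbrakk>u \<in> R; v \<in> R; int p dvd u - v\<rbrakk> \<Longrightarrow> u = v"
  by (simp flip: mod_eq_dvd_iff)

lemma e_add: "e (x + y) = e x * e y"
  by (simp add: e_char_def exp_add [symmetric] add_divide_distrib algebra_simps)

lemma e_0 [simp]: "e 0 = 1"
  by (simp add: e_char_def)

lemma e_cis: "e x = cis (2 * pi * x / p)"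
  by (simp add: e_char_def cis_conv_exp algebra_simps)

lemma e_minus: "e (- x) = cnj (e x)"
  by (simp add: e_cis cis_cnj)

lemma e_diff: "e (x - y) = e x * cnj (e y)"
  using e_add [of x "- y"] by (simp add: e_minus)

lemma norm_e [simp]: "norm (e x) = 1"
  by (simp add: e_cis)

lemma e_mult_cnj [simp]: "e x * cnj (e x) = 1" "cnj (e x) * e x = 1"
  using e_diff [of x x] by (simp_all add: mult.commute)

lemma e_eq_1_iff: "e x = 1 \<longleftrightarrow> int p dvd x"
proof -
  have "e x = 1 \<longleftrightarrow> (\<exists>k::int. 2 * pi * x / p = 2 * pi * k)"
    unfolding e_char_def exp_eq_1 by (auto simp: field_simps)
  also have "\<dots> \<longleftrightarrow> (\<exists>k::int. real_of_int x = real_of_int (int p * k))"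
    using p_pos by (auto simp: field_simps)
  also have "\<dots> \<longleftrightarrow> int p dvd x"
    unfolding of_int_eq_iff dvd_def ..
  finally show ?thesis .
qed

lemma e_cong: "x mod int p = y mod int p \<Longrightarrow> e x = e y"
proof -
  assume "x mod int p = y mod int p"
  then have "int p dvd x - y"
    by (simp add: mod_eq_dvd_iff)
  then have "e (x - y) = 1"
    by (simp add: e_eq_1_iff)
  then show "e x = e y"
    using e_add [of "x - y" y] by simp
qed

lemma e_mod_mult: "e (x + t mod int p * d) = e (x + t * d)"
  by (rule e_cong) (metis mod_add_right_eq mod_mult_left_eq)

text \<open>Multiplication by \<open>e a\<close> merely shifts the summation variable, so the sum is
  fixed by a factor that differs from \<open>1\<close> unless \<open>p\<close> divides
  \<open>a\<close>.\<close>

lemma sum_e: "(\<Sum>x\<in>R. e (x * a)) = (if int p dvd a then of_nat p else 0)"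
proof (cases "int p dvd a")
  case True
  then have "e (x * a) = 1" for x
    by (simp add: e_eq_1_iff)
  then show ?thesis
    using True by simp
next
  case False
  have "(\<Sum>x\<in>R. e (x * a)) * e a = (\<Sum>x\<in>R. e ((x + 1) * a))"
    by (simp add: sum_distrib_right distrib_right e_add)
  also have "\<dots> = (\<Sum>x\<in>R. e (((x + 1) mod int p) * a))"
    by (intro sum.cong refl e_cong) (simp add: mod_simps)
  also have "\<dots> = (\<Sum>x\<in>R. e (x * a))"
  proof (rule sum_reindex_endo [where f = "\<lambda>x. e (x * a)"])
    show "inj_on (\<lambda>u. (u + 1) mod int p) R"
      by (intro inj_onI) (simp add: mod_eq_dvd_iff R_eqI)
  qed auto
  finally have "(\<Sum>x\<in>R. e (x * a)) * (e a - 1) = 0"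
    by (simp add: algebra_simps)
  moreover have "e a \<noteq> 1"
    using False e_eq_1_iff by simp
  ultimately show ?thesis
    using False by simp
qed

lemma orth1:
  "(\<Sum>x\<in>R. e (x * a) * cnj (e (x * b))) = (if int p dvd a - b then of_nat p else 0)"
  by (simp add: e_diff [symmetric] right_diff_distrib [symmetric] sum_e)

lemma orth2:
  "(\<Sum>(x, y)\<in>R \<times> R. e (x * a + y * b) * cnj (e (x * c + y * d))) =
    (if int p dvd a - c \<and> int p dvd b - d then of_nat (p ^ 2) else 0)"
proof -
  have "(\<Sum>(x, y)\<in>R \<times> R. e (x * a + y * b) * cnj (e (x * c + y * d))) =
     (\<Sum>x\<in>R. e (x * (a - c))) * (\<Sum>y\<in>R. e (y * (b - d)))"
    by (simp add: sum_product sum.cartesian_product e_diff [symmetric] e_add [symmetric] algebra_simps)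
  then show ?thesis
    by (simp add: sum_e power2_eq_square)
qed

definition Off :: "(int \<times> int) set" where
  "Off = {(s, s') \<in> R \<times> R. s \<noteq> s'}"

lemma finite_Off [simp]: "finite Off"
  by (rule finite_subset [of _ "R \<times> R"]) (auto simp: Off_def)

lemma sum_diag_off:
  "(\<Sum>s\<in>R. \<Sum>s'\<in>R. f s s') = (\<Sum>s\<in>R. f s s) + (\<Sum>(s, s')\<in>Off. f s s')"
  for f :: "int \<Rightarrow> int \<Rightarrow> 'c::comm_monoid_add"
proof -
  have "(\<Sum>s\<in>R. \<Sum>s'\<in>R. f s s') = (\<Sum>(s, s')\<in>R \<times> R. f s s')"
    by (simp add: sum.cartesian_product)
  also have "R \<times> R = (\<lambda>s. (s, s)) ` R \<union> Off"
    by (auto simp: Off_def)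
  also have "(\<Sum>(s, s')\<in>(\<lambda>s. (s, s)) ` R \<union> Off. f s s') =
     (\<Sum>(s, s')\<in>(\<lambda>s. (s, s)) ` R. f s s') + (\<Sum>(s, s')\<in>Off. f s s')"
    using finite_Off by (intro sum.union_disjoint) (auto simp: Off_def)
  also have "(\<Sum>(s, s')\<in>(\<lambda>s. (s, s)) ` R. f s s') = (\<Sum>s\<in>R. f s s)"
    by (subst sum.reindex) (auto simp: inj_on_def)
  finally show ?thesis .
qed

end

section \<open>A fixed direction\<close>

text \<open>\<open>\<alpha>\<close> and \<open>\<beta>\<close> are the coordinates along and across a direction \<open>a\<close> of the plane, and \<open>n = a \<cdot> a\<close>.\<close>

locale direction = odd_paraboloid +
  fixes E :: "int \<Rightarrow> 'b set" and g :: "int \<Rightarrow> 'b \<Rightarrow> complex" and \<alpha> \<beta> :: "'b \<Rightarrow> int" and n :: int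
  assumes finite_E [simp]: "finite (E z)"
    and n_unit: "\<not> int p dvd n"
    and coords_inj: "\<lbrakk>y \<in> E z; y' \<in> E z; int p dvd \<alpha> y - \<alpha> y'; int p dvd \<beta> y - \<beta> y'\<rbrakk> \<Longrightarrow> y = y'"
    and norm_g: "y \<in> E z \<Longrightarrow> norm (g z y) = 1"
begin

definition fibre :: "int \<Rightarrow> int \<Rightarrow> 'b set" where
  "fibre z l = {y \<in> E z. \<beta> y mod int p = l}"

text \<open>Up to a scalar, \<open>V z l\<close> is the one-dimensional Schroedinger evolution over time \<open>z\<close> of
  \<open>g z\<close> restricted to the line \<open>fibre z l\<close>, on the Fourier side.\<close>

definition chirp :: "int \<Rightarrow> int \<Rightarrow> int \<Rightarrow> complex" where
  "chirp z t s = e (- (s * t + z * n * s\<^sup>2))"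

definition V :: "int \<Rightarrow> int \<Rightarrow> int \<Rightarrow> complex" where
  "V z l s = (\<Sum>y\<in>fibre z l. g z y * chirp z (\<alpha> y) s)"

text \<open>For an empty slice \<open>c z = 0\<close>, since \<open>1 / 0 = 0\<close>.\<close>

definition c :: "int \<Rightarrow> real" where
  "c z = 1 / card (E z)"

text \<open>Positive semidefinite, being a weighted sum of rank-one matrices. Up to a factor
  \<open>p\<close> it will be the matrix \<open>K a\<close> of the locale
  \<open>slices\<close>.\<close>

definition M :: "int \<Rightarrow> int \<Rightarrow> complex" where
  "M s s' = (\<Sum>(z, l)\<in>R \<times> R. of_real (c z) * (V z l s * cnj (V z l s')))"

text \<open>The quadratic form of the conjugate of \<open>M\<close>, written so that its
  nonnegativity is visible.\<close>

definition form :: "(int \<Rightarrow> complex) \<Rightarrow> real" where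
  "form u = (\<Sum>(z, l)\<in>R \<times> R. c z * (norm (\<Sum>s\<in>R. u s * cnj (V z l s)))\<^sup>2)"

definition offdiag :: real where
  "offdiag = (\<Sum>(s, s')\<in>Off. (norm (M s s'))\<^sup>2)"

text \<open>The off-diagonal part of \<open>form (chirp z t)\<close>, read as a trigonometric sum in
  time \<open>z\<close> and position \<open>t\<close>.\<close>

definition W :: "int \<Rightarrow> int \<Rightarrow> complex" where
  "W z t = (\<Sum>(s, s')\<in>Off. cnj (M s s') * e (z * (n * (s'\<^sup>2 - s\<^sup>2)) + t * (s' - s)))"

text \<open>The trace of \<open>M\<close>.\<close>

definition T :: real where
  "T = (\<Sum>s\<in>R. \<Sum>(z, l)\<in>R \<times> R. c z * (norm (V z l s))\<^sup>2)"

definition lines :: real where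
  "lines = (\<Sum>z\<in>R. c z * (\<Sum>l\<in>R. (real (card (fibre z l)))\<^sup>2))"

text \<open>The weight with which \<open>form (chirp z t)\<close> occurs once every
  \<open>form (V z l)\<close> has been bounded by \<open>form_V_le\<close>.\<close>

definition \<nu> :: "int \<Rightarrow> int \<Rightarrow> real" where
  "\<nu> z t = c z * (\<Sum>y\<in>{y \<in> E z. \<alpha> y mod int p = t}. real (card (fibre z (\<beta> y mod int p))))"

lemma c_nonneg [simp]: "c z \<ge> 0"
  by (simp add: c_def)

lemma finite_fibre [simp]: "finite (fibre z l)"
  by (simp add: fibre_def)

lemma fibre_Un: "(\<Union>l\<in>R. fibre z l) = E z"
  by (auto simp: fibre_def)

lemma sum_fibres: "(\<Sum>l\<in>R. \<Sum>y\<in>fibre z l. f y l) = (\<Sum>y\<in>E z. f y (\<beta> y mod int p))"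
proof -
  have "(\<Sum>l\<in>R. \<Sum>y\<in>fibre z l. f y l) = (\<Sum>l\<in>R. \<Sum>y\<in>fibre z l. f y (\<beta> y mod int p))"
    by (intro sum.cong refl) (auto simp: fibre_def)
  also have "\<dots> = (\<Sum>y\<in>(\<Union>l\<in>R. fibre z l). f y (\<beta> y mod int p))"
    by (rule sum.UNION_disjoint [symmetric]) (auto simp: fibre_def)
  finally show ?thesis
    by (simp add: fibre_Un)
qed

lemma sum_card_fibre: "(\<Sum>l\<in>R. real (card (fibre z l))) = card (E z)"
  using sum_fibres [of "\<lambda>_ _. 1::real" z] by simp

section \<open>The quadratic form of \<open>M\<close> and its Hilbert-Schmidt norm\<close>

lemma form_eq: "of_real (form u) = (\<Sum>s\<in>R. \<Sum>s'\<in>R. u s * cnj (u s') * cnj (M s s'))"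
proof -
  have "of_real (form u) =
      (\<Sum>(z, l)\<in>R \<times> R. of_real (c z) *
         ((\<Sum>s\<in>R. u s * cnj (V z l s)) * cnj (\<Sum>s\<in>R. u s * cnj (V z l s))))"
    unfolding form_def of_real_sum
    by (intro sum.cong refl)
      (simp only: case_prod_beta of_real_mult complex_norm_square split: prod.split)
  also have "\<dots> = (\<Sum>j\<in>R \<times> R. \<Sum>s\<in>R. \<Sum>s'\<in>R.
       u s * cnj (u s') * (of_real (c (fst j)) * (cnj (V (fst j) (snd j) s) * V (fst j) (snd j) s')))"
    unfolding cnj_sum sum_product case_prod_beta
    unfolding sum_distrib_left by (intro sum.cong refl) (simp add: mult_ac)
  also have "\<dots> = (\<Sum>s\<in>R. \<Sum>s'\<in>R. \<Sum>j\<in>R \<times> R.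
       u s * cnj (u s') * (of_real (c (fst j)) * (cnj (V (fst j) (snd j) s) * V (fst j) (snd j) s')))"
    by (subst sum.swap) (intro sum.cong refl sum.swap)
  also have "\<dots> = (\<Sum>s\<in>R. \<Sum>s'\<in>R. u s * cnj (u s') * cnj (M s s'))"
    by (simp add: M_def sum_distrib_left case_prod_beta)
  finally show ?thesis .
qed

text \<open>Expanding one of the two factors \<open>M\<close> into its rank-one terms leaves the
  other factor tested on each \<open>V z l\<close>.\<close>

lemma sum_norm_M: "(\<Sum>s\<in>R. \<Sum>s'\<in>R. (norm (M s s'))\<^sup>2) = (\<Sum>z\<in>R. c z * (\<Sum>l\<in>R. form (V z l)))"
proof -
  have *: "M s s' * y = (\<Sum>z\<in>R. \<Sum>l\<in>R. of_real (c z) * (V z l s * cnj (V z l s') * y))" for s s' y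
    unfolding M_def sum.cartesian_product [symmetric] sum_distrib_right by (simp only: mult.assoc)
  have "complex_of_real (\<Sum>s\<in>R. \<Sum>s'\<in>R. (norm (M s s'))\<^sup>2) = (\<Sum>s\<in>R. \<Sum>s'\<in>R. M s s' * cnj (M s s'))"
    unfolding of_real_sum complex_norm_square ..
  also have "\<dots> = (\<Sum>s\<in>R. \<Sum>s'\<in>R. \<Sum>z\<in>R. \<Sum>l\<in>R.
      of_real (c z) * (V z l s * cnj (V z l s') * cnj (M s s')))"
    by (simp only: *)
  also have "\<dots> = (\<Sum>s\<in>R. \<Sum>z\<in>R. \<Sum>s'\<in>R. \<Sum>l\<in>R.
      of_real (c z) * (V z l s * cnj (V z l s') * cnj (M s s')))"
    by (intro sum.cong refl sum.swap)
  also have "\<dots> = (\<Sum>z\<in>R. \<Sum>s\<in>R. \<Sum>s'\<in>R. \<Sum>l\<in>R.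
      of_real (c z) * (V z l s * cnj (V z l s') * cnj (M s s')))"
    by (rule sum.swap)
  also have "\<dots> = (\<Sum>z\<in>R. \<Sum>s\<in>R. \<Sum>l\<in>R. \<Sum>s'\<in>R.
      of_real (c z) * (V z l s * cnj (V z l s') * cnj (M s s')))"
    by (intro sum.cong refl sum.swap)
  also have "\<dots> = (\<Sum>z\<in>R. \<Sum>l\<in>R. \<Sum>s\<in>R. \<Sum>s'\<in>R.
      of_real (c z) * (V z l s * cnj (V z l s') * cnj (M s s')))"
    by (intro sum.cong refl sum.swap)
  also have "\<dots> = of_real (\<Sum>z\<in>R. c z * (\<Sum>l\<in>R. form (V z l)))"
    by (simp only: of_real_sum of_real_mult form_eq sum_distrib_left)
  finally show ?thesis
    by (simp only: of_real_eq_iff)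
qed

text \<open>This is the operator inequality \<open>v v* \<le> k diag(1)\<close> for a unimodular \<open>v\<close> supported on \<open>k\<close>
  points, tested against the positive form of \<open>M\<close>.\<close>

lemma form_V_le: "form (V z l) \<le> card (fibre z l) * (\<Sum>y\<in>fibre z l. form (chirp z (\<alpha> y)))"
proof -
  have "(\<Sum>s\<in>R. V z l s * cnj (v s)) = (\<Sum>y\<in>fibre z l. g z y * (\<Sum>s\<in>R. chirp z (\<alpha> y) s * cnj (v s)))" for v
    unfolding V_def sum_distrib_left sum_distrib_right
    by (subst sum.swap) (simp add: mult_ac)
  then have *: "(norm (\<Sum>s\<in>R. V z l s * cnj (v s)))\<^sup>2 \<le>
      card (fibre z l) * (\<Sum>y\<in>fibre z l. (norm (\<Sum>s\<in>R. chirp z (\<alpha> y) s * cnj (v s)))\<^sup>2)" for v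
    using norm_sum_squared_le [of "\<lambda>y. g z y * (\<Sum>s\<in>R. chirp z (\<alpha> y) s * cnj (v s))" "fibre z l"]
    by (simp add: norm_mult norm_g fibre_def)
  have "form (V z l) \<le> (\<Sum>j\<in>R \<times> R. c (fst j) * (card (fibre z l) *
     (\<Sum>y\<in>fibre z l. (norm (\<Sum>s\<in>R. chirp z (\<alpha> y) s * cnj (V (fst j) (snd j) s)))\<^sup>2)))"
    unfolding form_def case_prod_beta by (intro sum_mono mult_left_mono * c_nonneg)
  also have "\<dots> = card (fibre z l) * (\<Sum>j\<in>R \<times> R. \<Sum>y\<in>fibre z l.
      c (fst j) * (norm (\<Sum>s\<in>R. chirp z (\<alpha> y) s * cnj (V (fst j) (snd j) s)))\<^sup>2)"
    by (simp add: sum_distrib_left mult_ac)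
  also have "\<dots> = card (fibre z l) * (\<Sum>y\<in>fibre z l. form (chirp z (\<alpha> y)))"
    unfolding form_def case_prod_beta by (subst sum.swap) simp
  finally show ?thesis .
qed

lemma T_eq: "(\<Sum>s\<in>R. cnj (M s s)) = of_real T"
  unfolding T_def M_def of_real_sum cnj_sum case_prod_beta of_real_mult complex_norm_square
  by (intro sum.cong refl) (simp add: mult_ac)

text \<open>A chirp has unimodular entries, so the diagonal of \<open>M\<close> contributes the
  trace whatever \<open>z\<close> and \<open>t\<close> are.\<close>

lemma form_chirp: "form (chirp z t) = T + Re (W z t)"
proof -
  have "complex_of_real (form (chirp z t)) =
      (\<Sum>s\<in>R. \<Sum>s'\<in>R. chirp z t s * cnj (chirp z t s') * cnj (M s s'))"
    by (rule form_eq)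
  also have "\<dots> = (\<Sum>s\<in>R. chirp z t s * cnj (chirp z t s) * cnj (M s s)) +
      (\<Sum>(s, s')\<in>Off. chirp z t s * cnj (chirp z t s') * cnj (M s s'))"
    by (rule sum_diag_off)
  also have "(\<Sum>s\<in>R. chirp z t s * cnj (chirp z t s) * cnj (M s s)) = of_real T"
    by (simp add: chirp_def T_eq)
  also have "(\<Sum>(s, s')\<in>Off. chirp z t s * cnj (chirp z t s') * cnj (M s s')) = W z t"
    unfolding W_def chirp_def
    by (intro sum.cong refl) (auto simp: e_diff [symmetric] algebra_simps)
  finally show ?thesis
    by (metis Re_complex_of_real plus_complex.simps(1))
qed

lemma W_mod: "W z (t mod int p) = W z t"
  unfolding W_def
  by (simp add: e_mod_mult)

text \<open>The key identity: as the parabola is a Sidon set, distinct off-diagonal entries of \<open>M\<close> have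
  distinct frequencies in \<open>W\<close>.\<close>

lemma sum_norm_W: "(\<Sum>(z, t)\<in>R \<times> R. (norm (W z t))\<^sup>2) = p ^ 2 * offdiag"
proof -
  have inj: "i = j" if "i \<in> Off" "j \<in> Off"
      "int p dvd n * ((snd i)\<^sup>2 - (fst i)\<^sup>2) - n * ((snd j)\<^sup>2 - (fst j)\<^sup>2)"
      "int p dvd (snd i - fst i) - (snd j - fst j)" for i j
  proof -
    obtain a b c d where ij: "i = (a, b)" "j = (c, d)"
      by fastforce
    have R: "a \<in> R" "b \<in> R" "c \<in> R" "d \<in> R" "a \<noteq> b" "c \<noteq> d"
      using that by (auto simp: Off_def ij)
    from R have "\<not> int p dvd b - a"
      by (auto simp: mod_eq_dvd_iff [symmetric])
    have "int p dvd n * ((b\<^sup>2 - a\<^sup>2) - (d\<^sup>2 - c\<^sup>2))"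
      using that by (simp add: ij algebra_simps)
    then have "int p dvd (b\<^sup>2 - a\<^sup>2) - (d\<^sup>2 - c\<^sup>2)"
      using n_unit prime_dvd_mult_iff [OF prime_int_p] by blast
    moreover have "int p dvd (b - a) - (d - c)"
      using that by (simp add: ij)
    then have "int p dvd ((b - a) - (d - c)) * (d + c)"
      by simp
    \<comment> \<open>Since a difference of squares is difference times sum, inserting the equality
      of the differences leaves \<open>b - a\<close> times the difference of the sums. As
      \<open>b - a\<close> is a unit, the sums agree too, and \<open>2\<close> being invertible, the
      entries agree.\<close>
    ultimately have "int p dvd (b\<^sup>2 - a\<^sup>2) - (d\<^sup>2 - c\<^sup>2) - ((b - a) - (d - c)) * (d + c)"
      by (rule dvd_diff)
    also have "(b\<^sup>2 - a\<^sup>2) - (d\<^sup>2 - c\<^sup>2) - ((b - a) - (d - c)) * (d + c) = (b - a) * ((b + a) - (d + c))"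
      by (simp add: power2_eq_square algebra_simps)
    finally have "int p dvd (b + a) - (d + c)"
      using \<open>\<not> int p dvd b - a\<close> prime_dvd_mult_iff [OF prime_int_p] by blast
    with \<open>int p dvd (b - a) - (d - c)\<close>
    have "int p dvd ((b + a) - (d + c)) + ((b - a) - (d - c))" "int p dvd ((b + a) - (d + c)) - ((b - a) - (d - c))"
      by (blast intro: dvd_add dvd_diff)+
    moreover have "((b + a) - (d + c)) + ((b - a) - (d - c)) = 2 * (b - d)"
        "((b + a) - (d + c)) - ((b - a) - (d - c)) = 2 * (a - c)"
      by simp_all
    ultimately have "int p dvd b - d" "int p dvd a - c"
      by (simp_all only: two_dvd_cancel)
    then have "b mod int p = d mod int p" "a mod int p = c mod int p"
      by (simp_all only: mod_eq_dvd_iff)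
    with R show ?thesis
      by (simp add: ij)
  qed
  have "(\<Sum>x\<in>R \<times> R. (norm (W (fst x) (snd x)))\<^sup>2) =
      (\<Sum>x\<in>R \<times> R. (norm (\<Sum>i\<in>Off. cnj (M (fst i) (snd i)) *
         e (fst x * (n * ((snd i)\<^sup>2 - (fst i)\<^sup>2)) + snd x * (snd i - fst i))))\<^sup>2)"
    by (simp add: W_def case_prod_beta)
  also have "\<dots> = real (p ^ 2) * (\<Sum>i\<in>Off. (norm (cnj (M (fst i) (snd i))))\<^sup>2)"
  proof (rule sum_norm_parseval)
    fix i j assume "i \<in> Off" "j \<in> Off"
    then show "(\<Sum>x\<in>R \<times> R. e (fst x * (n * ((snd i)\<^sup>2 - (fst i)\<^sup>2)) + snd x * (snd i - fst i)) *
         cnj (e (fst x * (n * ((snd j)\<^sup>2 - (fst j)\<^sup>2)) + snd x * (snd j - fst j)))) =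
        (if i = j then complex_of_real (real (p ^ 2)) else 0)"
      unfolding orth2 [unfolded case_prod_beta] using inj [of i j] by auto
  qed simp
  finally show ?thesis
    by (simp add: offdiag_def case_prod_beta)
qed

text \<open>The quadratic phase of \<open>V z l s\<close> depends on \<open>s\<close> alone and
  factors out. Points of one line have distinct \<open>\<alpha>\<close>, so Plancherel in
  \<open>s\<close> gives \<open>p\<close> per point. The weight \<open>c z\<close> reduces each
  nonempty slice to \<open>p\<close>; empty slices give \<open>0\<close>.\<close>

lemma T_le: "T \<le> real p ^ 2"
proof -
  have *: "(\<Sum>s\<in>R. (norm (V z l s))\<^sup>2) = real p * real (card (fibre z l))" for z l
  proof -
    have "norm (V z l s) = norm (\<Sum>y\<in>fibre z l. g z y * e (s * - \<alpha> y))" for s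
    proof -
      have "V z l s = e (- (z * n * s\<^sup>2)) * (\<Sum>y\<in>fibre z l. g z y * e (s * - \<alpha> y))"
        unfolding V_def chirp_def sum_distrib_left
        by (intro sum.cong refl) (simp add: e_add [symmetric] algebra_simps flip: e_add)
      then show ?thesis
        by (simp add: norm_mult)
    qed
    then have "(\<Sum>s\<in>R. (norm (V z l s))\<^sup>2) = (\<Sum>s\<in>R. (norm (\<Sum>y\<in>fibre z l. g z y * e (s * - \<alpha> y)))\<^sup>2)"
      by simp
    also have "\<dots> = real p * (\<Sum>y\<in>fibre z l. (norm (g z y))\<^sup>2)"
    proof (rule sum_norm_parseval)
      fix i j assume ij: "i \<in> fibre z l" "j \<in> fibre z l"
      then have "i = j" if "int p dvd - \<alpha> i - - \<alpha> j"
      proof -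
        have "int p dvd \<beta> i - \<beta> j"
          using ij by (simp add: fibre_def mod_eq_dvd_iff [symmetric])
        moreover have "int p dvd \<alpha> i - \<alpha> j"
          using that by (simp add: dvd_diff_commute)
        ultimately show ?thesis
          using ij coords_inj unfolding fibre_def by blast
      qed
      then show "(\<Sum>s\<in>R. e (s * - \<alpha> i) * cnj (e (s * - \<alpha> j))) = (if i = j then complex_of_real (real p) else 0)"
        unfolding orth1 by auto
    qed simp
    also have "(\<Sum>y\<in>fibre z l. (norm (g z y))\<^sup>2) = card (fibre z l)"
      by (simp add: norm_g fibre_def)
    finally show ?thesis .
  qed
  have "T = (\<Sum>z\<in>R. \<Sum>l\<in>R. c z * (\<Sum>s\<in>R. (norm (V z l s))\<^sup>2))"
    unfolding T_def sum.cartesian_product [symmetric] sum_distrib_left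
    by (subst sum.swap) (intro sum.cong refl sum.swap)
  also have "\<dots> = (\<Sum>z\<in>R. c z * p * (\<Sum>l\<in>R. real (card (fibre z l))))"
    by (simp add: * sum_distrib_left mult_ac)
  also have "\<dots> \<le> (\<Sum>z\<in>R. real p)"
    by (intro sum_mono) (simp add: sum_card_fibre c_def)
  finally show ?thesis
    by (simp add: power2_eq_square)
qed

lemma nu_nonneg: "\<nu> z t \<ge> 0"
  by (simp add: \<nu>_def sum_nonneg)

text \<open>Slice points with the same \<open>\<alpha>\<close> lie on different lines, so their line
  sizes add up to at most the size of the slice.\<close>

lemma nu_le_1: "\<nu> z t \<le> 1"
proof -
  let ?A = "{y \<in> E z. \<alpha> y mod int p = t}"
  have inj: "inj_on (\<lambda>y. \<beta> y mod int p) ?A"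
    by (intro inj_onI, rule coords_inj [of _ z]) (auto simp flip: mod_eq_dvd_iff)
  have "(\<Sum>y\<in>?A. real (card (fibre z (\<beta> y mod int p)))) =
      (\<Sum>l\<in>(\<lambda>y. \<beta> y mod int p) ` ?A. real (card (fibre z l)))"
    by (simp add: sum.reindex [OF inj])
  also have "\<dots> \<le> (\<Sum>l\<in>R. real (card (fibre z l)))"
    by (intro sum_mono2) auto
  also have "\<dots> = card (E z)"
    by (rule sum_card_fibre)
  finally have "\<nu> z t \<le> c z * card (E z)"
    unfolding \<nu>_def by (intro mult_left_mono) auto
  also have "\<dots> \<le> 1"
    by (simp add: c_def)
  finally show ?thesis .
qed

lemma sum_residues:
  "(\<Sum>t\<in>R. (\<Sum>y\<in>{y \<in> E z. \<alpha> y mod int p = t}. f y) * h t) = (\<Sum>y\<in>E z. f y * h (\<alpha> y mod int p))"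
  for f :: "'b \<Rightarrow> real"
proof -
  have "(\<Sum>t\<in>R. (\<Sum>y\<in>{y \<in> E z. \<alpha> y mod int p = t}. f y) * h t) =
      (\<Sum>t\<in>R. \<Sum>y\<in>{y \<in> E z. \<alpha> y mod int p = t}. f y * h (\<alpha> y mod int p))"
    by (simp add: sum_distrib_right)
  also have "\<dots> = (\<Sum>y\<in>E z. f y * h (\<alpha> y mod int p))"
    by (rule sum.group) auto
  finally show ?thesis .
qed

lemma sum_nu: "(\<Sum>z\<in>R. \<Sum>t\<in>R. \<nu> z t) = lines"
proof -
  have "(\<Sum>t\<in>R. \<nu> z t) = c z * (\<Sum>l\<in>R. (real (card (fibre z l)))\<^sup>2)" for z
    using sum_residues [of "\<lambda>y. real (card (fibre z (\<beta> y mod int p)))" z "\<lambda>_. 1"]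
      sum_fibres [of "\<lambda>y l. real (card (fibre z l))" z]
    by (simp add: \<nu>_def sum_distrib_left [symmetric] power2_eq_square)
  then show ?thesis
    by (simp add: lines_def)
qed

text \<open>The Hilbert-Schmidt norm is bounded by pairing \<open>\<nu>\<close> with
  \<open>T + Re W\<close>. As the norm of \<open>W\<close> is again \<open>offdiag\<close>, the
  pairing with \<open>W\<close> can be absorbed: it costs \<open>offdiag / 2\<close>, and
  \<open>1 + 1/2\<close> copies of \<open>p ^ 2 * lines\<close> remain, whence the factor
  \<open>3\<close>.\<close>

lemma offdiag_le: "offdiag \<le> 3 * real p ^ 2 * lines"
proof -
  have "offdiag \<le> (\<Sum>s\<in>R. (norm (M s s))\<^sup>2) + offdiag"
    by (simp add: sum_nonneg)
  also have "\<dots> = (\<Sum>s\<in>R. \<Sum>s'\<in>R. (norm (M s s'))\<^sup>2)"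
    unfolding offdiag_def by (rule sum_diag_off [symmetric])
  also have "\<dots> = (\<Sum>z\<in>R. c z * (\<Sum>l\<in>R. form (V z l)))"
    by (rule sum_norm_M)
  also have "\<dots> \<le> (\<Sum>z\<in>R. c z * (\<Sum>l\<in>R. card (fibre z l) * (\<Sum>y\<in>fibre z l. form (chirp z (\<alpha> y)))))"
    by (intro sum_mono mult_left_mono form_V_le c_nonneg)
  also have "\<dots> = (\<Sum>z\<in>R. c z * (\<Sum>y\<in>E z. card (fibre z (\<beta> y mod int p)) * form (chirp z (\<alpha> y))))"
    by (simp add: sum_distrib_left sum_fibres)
  also have "\<dots> = (\<Sum>z\<in>R. c z * (\<Sum>y\<in>E z. card (fibre z (\<beta> y mod int p)) * (T + Re (W z (\<alpha> y mod int p)))))"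
    by (simp add: form_chirp W_mod)
  also have "\<dots> = (\<Sum>z\<in>R. \<Sum>t\<in>R. \<nu> z t * (T + Re (W z t)))"
    by (simp only: \<nu>_def mult.assoc sum_distrib_left [symmetric] sum_residues)
  also have "\<dots> = lines * T + (\<Sum>z\<in>R. \<Sum>t\<in>R. \<nu> z t * Re (W z t))"
    by (simp add: distrib_left sum.distrib sum_distrib_right [symmetric] sum_nu)
  \<comment> \<open>The weight \<open>p ^ 2\<close> in the arithmetic-geometric mean inequality is
    the one for which \<open>sum_norm_W\<close> turns the \<open>W\<close> part into exactly
    \<open>offdiag / 2\<close>. The square of \<open>\<nu>\<close> is replaced by
    \<open>\<nu>\<close>, as it lies between \<open>0\<close> and \<open>1\<close>.\<close>
  also have "\<dots> \<le> lines * real p ^ 2 + (\<Sum>z\<in>R. \<Sum>t\<in>R. (p ^ 2 / 2) * \<nu> z t + (norm (W z t))\<^sup>2 / (2 * p ^ 2))"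
  proof (intro add_mono sum_mono mult_left_mono T_le)
    show "lines \<ge> 0"
      by (simp add: lines_def sum_nonneg)
    fix z t
    have "2 * real p ^ 2 * (\<nu> z t * Re (W z t)) \<le> (real p ^ 2 * \<nu> z t)\<^sup>2 + (Re (W z t))\<^sup>2"
      using sum_squares_bound [of "real p ^ 2 * \<nu> z t" "Re (W z t)"] by (simp add: mult_ac)
    also have "\<dots> \<le> (real p ^ 2)\<^sup>2 * \<nu> z t + (norm (W z t))\<^sup>2"
    proof (rule add_mono)
      have "(\<nu> z t)\<^sup>2 \<le> \<nu> z t"
        using nu_nonneg nu_le_1 by (simp add: power2_eq_square mult_left_le)
      then show "(real p ^ 2 * \<nu> z t)\<^sup>2 \<le> (real p ^ 2)\<^sup>2 * \<nu> z t"
        by (simp add: power_mult_distrib mult_left_mono)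
      show "(Re (W z t))\<^sup>2 \<le> (norm (W z t))\<^sup>2"
        by (simp add: cmod_power2)
    qed
    finally show "\<nu> z t * Re (W z t) \<le> (p ^ 2 / 2) * \<nu> z t + (norm (W z t))\<^sup>2 / (2 * p ^ 2)"
      using p_pos by (simp add: field_simps power2_eq_square)
  qed
  also have "\<dots> = lines * real p ^ 2 + (p ^ 2 / 2 * lines + offdiag / 2)"
  proof -
    have "(\<Sum>z\<in>R. \<Sum>t\<in>R. (norm (W z t))\<^sup>2 / (2 * p ^ 2)) = offdiag / 2"
      using sum_norm_W p_pos
      by (simp add: sum.cartesian_product [symmetric] sum_divide_distrib [symmetric])
    moreover have "(\<Sum>z\<in>R. \<Sum>t\<in>R. (p ^ 2 / 2) * \<nu> z t) = p ^ 2 / 2 * lines"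
      by (simp only: sum_nu [symmetric] sum_distrib_left)
    ultimately show ?thesis
      by (simp only: sum.distrib)
  qed
  finally show ?thesis
    by (simp add: field_simps)
qed

end

section \<open>Plane vectors modulo \<open>p\<close>\<close>

text \<open>Vectors are unreduced integer pairs: characters see only residues, so reduction is
  postponed to \<open>red\<close>.\<close>

definition ip :: "int \<times> int \<Rightarrow> int \<times> int \<Rightarrow> int" where
  "ip u v = fst u * fst v + snd u * snd v"

definition perp :: "int \<times> int \<Rightarrow> int \<times> int" where
  "perp u = (- snd u, fst u)"

definition scale :: "int \<Rightarrow> int \<times> int \<Rightarrow> int \<times> int" where
  "scale r u = (r * fst u, r * snd u)"

definition frame :: "int \<times> int \<Rightarrow> int \<Rightarrow> int \<Rightarrow> int \<times> int" where
  "frame a s w = scale s a + scale w (perp a)"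

lemmas vec_defs = ip_def perp_def scale_def frame_def

lemma ip_frame: "ip y (frame a s w) = s * ip y a + w * ip y (perp a)"
  by (simp add: vec_defs algebra_simps)

lemma ip_frame_frame: "ip (frame a s w) (frame a s w) = ip a a * (s\<^sup>2 + w\<^sup>2)"
  by (simp add: vec_defs algebra_simps power2_eq_square)

lemma ip_frame_base: "ip (frame a s w) a = s * ip a a"
  by (simp add: vec_defs algebra_simps)

lemma frame_add: "frame a s w + a = frame a (s + 1) w"
  by (simp add: vec_defs algebra_simps prod_eq_iff)

lemma frame_scale: "frame (scale r a) s w = frame a (r * s) (r * w)"
  by (simp add: vec_defs algebra_simps prod_eq_iff)

context odd_paraboloid
begin

definition red :: "int \<times> int \<Rightarrow> int \<times> int" where
  "red u = (fst u mod int p, snd u mod int p)"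

abbreviation R2 :: "(int \<times> int) set" where "R2 \<equiv> R \<times> R"

definition R2' :: "(int \<times> int) set" where "R2' = R2 - {0}"

lemma red_in [simp]: "red u \<in> R2"
  by (simp add: red_def)

lemma red_id: "u \<in> R2 \<Longrightarrow> red u = u"
  by (auto simp: red_def)

lemma red_eq_iff: "red u = red v \<longleftrightarrow> int p dvd fst u - fst v \<and> int p dvd snd u - snd v"
  by (simp add: red_def mod_eq_dvd_iff)

lemma R2_eqI:
  assumes "u \<in> R2" "v \<in> R2" "int p dvd fst u - fst v" "int p dvd snd u - snd v"
  shows "u = v"
  by (metis assms red_eq_iff red_id)

lemma zero_in_R2 [simp]: "0 \<in> R2"
  by (simp add: zero_prod_def)

lemma finite_R2' [simp]: "finite R2'"
  by (simp add: R2'_def)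

lemma prime_dvd_multE: "int p dvd x * y \<Longrightarrow> \<not> int p dvd x \<Longrightarrow> int p dvd y"
  using prime_dvd_mult_iff [OF prime_int_p] by blast

lemma ip_self_unit:
  assumes "a \<in> R2'"
  shows "\<not> int p dvd ip a a"
proof
  assume "int p dvd ip a a"
  then have "int p dvd fst a - 0 \<and> int p dvd snd a - 0"
    using sum_squares_dvd [of "fst a" "snd a"] by (simp add: ip_def)
  then have "a = 0"
    using assms by (intro R2_eqI) (auto simp: R2'_def)
  with assms show False
    by (simp add: R2'_def)
qed

text \<open>Cramer's rule: \<open>a\<close> and \<open>perp a\<close> have determinant
  \<open>ip a a\<close>, a unit by anisotropy.\<close>

lemma frame_coords_dvd:
  assumes "a \<in> R2'" "int p dvd ip v a" "int p dvd ip v (perp a)"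
  shows "int p dvd fst v" "int p dvd snd v"
proof -
  have "int p dvd fst a * ip v a - snd a * ip v (perp a)" "int p dvd snd a * ip v a + fst a * ip v (perp a)"
    using assms by simp_all
  moreover have "fst a * ip v a - snd a * ip v (perp a) = ip a a * fst v"
      "snd a * ip v a + fst a * ip v (perp a) = ip a a * snd v"
    by (simp_all add: vec_defs algebra_simps)
  ultimately show "int p dvd fst v" "int p dvd snd v"
    using prime_dvd_multE ip_self_unit [OF assms(1)] by metis+
qed

section \<open>Linear changes of variables modulo \<open>p\<close>\<close>

lemma sum_R_reindex:
  fixes f :: "int \<Rightarrow> 'a::comm_monoid_add"
  assumes "\<And>u. f (u mod int p) = f u"
    and "\<And>u v. \<lbrakk>u \<in> R; v \<in> R; int p dvd h u - h v\<rbrakk> \<Longrightarrow> u = v"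
  shows "(\<Sum>u\<in>R. f (h u)) = (\<Sum>u\<in>R. f u)"
proof -
  have "(\<Sum>u\<in>R. f (h u)) = (\<Sum>u\<in>R. f (h u mod int p))"
    by (simp add: assms(1))
  also have "\<dots> = (\<Sum>u\<in>R. f u)"
    by (rule sum_reindex_endo) (auto simp: mod_eq_dvd_iff assms(2) intro!: inj_onI)
  finally show ?thesis .
qed

lemma sum_R2_reindex:
  fixes f :: "int \<times> int \<Rightarrow> 'a::comm_monoid_add"
  assumes "\<And>u. f (red u) = f u"
    and "\<And>u v. \<lbrakk>u \<in> R2; v \<in> R2; red (h u) = red (h v)\<rbrakk> \<Longrightarrow> u = v"
  shows "(\<Sum>u\<in>R2. f (h u)) = (\<Sum>u\<in>R2. f u)"
proof -
  have "(\<Sum>u\<in>R2. f (h u)) = (\<Sum>u\<in>R2. f (red (h u)))"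
    by (simp add: assms(1))
  also have "\<dots> = (\<Sum>u\<in>R2. f u)"
    by (rule sum_reindex_endo) (simp, simp, rule inj_onI, rule assms(2), assumption+)
  finally show ?thesis .
qed

lemma sum_R_shift:
  assumes "\<And>u. f (u mod int p) = f u"
  shows "(\<Sum>u\<in>R. f (u + c)) = (\<Sum>u\<in>R. f u)"
  using assms by (rule sum_R_reindex) (simp add: R_eqI)

lemma sum_R_scale:
  assumes "\<And>u. f (u mod int p) = f u" "\<not> int p dvd r"
  shows "(\<Sum>u\<in>R. f (r * u)) = (\<Sum>u\<in>R. f u)"
  using assms(1)
proof (rule sum_R_reindex)
  fix u v assume "u \<in> R" "v \<in> R" "int p dvd r * u - r * v"
  then show "u = v"
    using assms(2) prime_dvd_multE by (metis R_eqI right_diff_distrib)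
qed

lemma sum_R2_shift:
  assumes "\<And>u. f (red u) = f u"
  shows "(\<Sum>u\<in>R2. f (u + a)) = (\<Sum>u\<in>R2. f u)"
  using assms
proof (rule sum_R2_reindex)
  fix u v assume "u \<in> R2" "v \<in> R2" "red (u + a) = red (v + a)"
  then show "u = v"
    by (intro R2_eqI) (simp_all add: red_eq_iff)
qed

lemma sum_R2_frame:
  assumes "\<And>u. f (red u) = f u" "a \<in> R2'"
  shows "(\<Sum>(s, w)\<in>R2. f (frame a s w)) = (\<Sum>u\<in>R2. f u)"
proof -
  have "(\<Sum>u\<in>R2. f (frame a (fst u) (snd u))) = (\<Sum>u\<in>R2. f u)"
    using assms(1)
  proof (rule sum_R2_reindex)
    fix u v assume uv: "u \<in> R2" "v \<in> R2" "red (frame a (fst u) (snd u)) = red (frame a (fst v) (snd v))"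
    define d where "d = u - v"
    have *: "int p dvd fst (frame a (fst d) (snd d))" "int p dvd snd (frame a (fst d) (snd d))"
      using uv(3) by (simp_all add: red_eq_iff d_def vec_defs algebra_simps)
    have "int p dvd ip (frame a (fst d) (snd d)) a" "int p dvd ip (frame a (fst d) (snd d)) (perp a)"
      using * by (auto simp: ip_def)
    moreover have "ip (frame a (fst d) (snd d)) a = ip a a * fst d" "ip (frame a (fst d) (snd d)) (perp a) = ip a a * snd d"
      by (simp_all add: vec_defs algebra_simps)
    ultimately have "int p dvd fst d" "int p dvd snd d"
      using ip_self_unit [OF assms(2)] prime_dvd_multE by metis+
    then show "u = v"
      using uv(1,2) by (intro R2_eqI) (simp_all add: d_def)
  qed
  then show ?thesis
    by (simp add: case_prod_beta)
qed

lemma sum_R2'_scale: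
  assumes "\<And>u. f (red u) = f u" "\<not> int p dvd r"
  shows "(\<Sum>u\<in>R2'. f (scale r u)) = (\<Sum>u\<in>R2'. f u)"
proof -
  have *: "int p dvd r * x - r * y \<Longrightarrow> int p dvd x - y" for x y
    using assms(2) prime_dvd_multE by (metis right_diff_distrib)
  have "(\<Sum>u\<in>R2'. f (scale r u)) = (\<Sum>u\<in>R2'. f (red (scale r u)))"
    by (simp add: assms(1))
  also have "\<dots> = (\<Sum>u\<in>R2'. f u)"
  proof (rule sum_reindex_endo)
    fix u assume u: "u \<in> R2'"
    have "red (scale r u) \<noteq> 0"
    proof
      assume "red (scale r u) = 0"
      then have "red (scale r u) = red 0"
        by (simp add: red_id)
      then have "u = 0"
        using u * [of "fst u" 0] * [of "snd u" 0] by (intro R2_eqI) (simp_all add: red_eq_iff scale_def R2'_def)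
      with u show False
        by (simp add: R2'_def)
    qed
    then show "red (scale r u) \<in> R2'"
      by (simp add: R2'_def)
  next
    show "inj_on (\<lambda>u. red (scale r u)) R2'"
      by (intro inj_onI R2_eqI) (simp_all add: red_eq_iff scale_def R2'_def *)
  qed simp
  finally show ?thesis .
qed

text \<open>The condition forces \<open>a\<close> to be parallel to the nonzero vector
  \<open>y - y'\<close>. On that line one coordinate determines \<open>a\<close> and is nonzero,
  which leaves at most \<open>p - 1\<close> choices.\<close>

lemma card_perp_le:
  assumes "y \<in> R2" "y' \<in> R2" "y \<noteq> y'"
  shows "card {a \<in> R2'. ip y (perp a) mod int p = ip y' (perp a) mod int p} \<le> p - 1"
proof -
  define A where "A = {a \<in> R2'. ip y (perp a) mod int p = ip y' (perp a) mod int p}"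
  define v where "v = y - y'"
  have v: "int p dvd snd v * fst a - fst v * snd a" if "a \<in> A" for a
    using that by (simp add: A_def mod_eq_dvd_iff vec_defs v_def algebra_simps)
  have v0: "\<not> int p dvd fst v \<or> \<not> int p dvd snd v"
    using R2_eqI [OF assms(1,2)] assms(3) by (auto simp: v_def)
  have bound: "card A \<le> p - 1"
    if f: "\<And>a. a \<in> A \<Longrightarrow> f a \<in> R" "\<And>a b. \<lbrakk>a \<in> A; b \<in> A; f a = f b\<rbrakk> \<Longrightarrow> a = b"
      and f0: "\<And>a. a \<in> A \<Longrightarrow> f a \<noteq> 0" for f :: "int \<times> int \<Rightarrow> int"
  proof -
    have "card A \<le> card (R - {0})"
    proof (rule card_inj_on_le)
      show "inj_on f A"
        by (rule inj_onI) (rule f(2))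
      show "f ` A \<subseteq> R - {0}"
      proof (rule image_subsetI)
        fix a assume "a \<in> A"
        then show "f a \<in> R - {0}"
          using f(1) [of a] f0 [of a] by simp
      qed
    qed simp
    also have "\<dots> = p - 1"
      by (simp add: card_Diff_singleton)
    finally show ?thesis .
  qed
  have cancel: "a = b" if "int p dvd x * a - x * b" "\<not> int p dvd x" "a \<in> R" "b \<in> R" for a b x :: int
    using that prime_dvd_multE by (metis R_eqI right_diff_distrib)
  have diff: "int p dvd (snd v * fst a - fst v * snd a) - (snd v * fst b - fst v * snd b)"
    if "a \<in> A" "b \<in> A" for a b
    using v that by (blast intro: dvd_diff)
  from v0 have "card A \<le> p - 1"
  proof
    assume nz: "\<not> int p dvd snd v"
    show ?thesis
    proof (rule bound [of snd])
      fix a b assume ab: "a \<in> A" "b \<in> A" "snd a = snd b"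
      have "int p dvd snd v * fst a - snd v * fst b"
        using diff [OF ab(1,2)] ab(3) by simp
      then show "a = b"
        using cancel [OF _ nz, of "fst a" "fst b"] ab by (auto simp: A_def R2'_def prod_eq_iff)
    next
      fix a assume a: "a \<in> A"
      show "snd a \<noteq> 0"
      proof
        assume "snd a = 0"
        then have "int p dvd snd v * fst a - snd v * 0"
          using v [OF a] by simp
        then have "fst a = 0"
          using cancel [OF _ nz, of "fst a" 0] a by (auto simp: A_def R2'_def)
        with \<open>snd a = 0\<close> a show False
          by (auto simp: A_def R2'_def prod_eq_iff)
      qed
    qed (auto simp: A_def R2'_def)
  next
    assume nz: "\<not> int p dvd fst v"
    show ?thesis
    proof (rule bound [of fst])
      fix a b assume ab: "a \<in> A" "b \<in> A" "fst a = fst b"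
      have "int p dvd fst v * snd b - fst v * snd a"
        using diff [OF ab(1,2)] ab(3) by simp
      then show "a = b"
        using cancel [OF _ nz, of "snd b" "snd a"] ab by (auto simp: A_def R2'_def prod_eq_iff)
    next
      fix a assume a: "a \<in> A"
      show "fst a \<noteq> 0"
      proof
        assume "fst a = 0"
        then have "int p dvd fst v * 0 - fst v * snd a"
          using v [OF a] by simp
        then have "snd a = 0"
          using cancel [OF _ nz, of 0 "snd a"] a by (auto simp: A_def R2'_def)
        with \<open>fst a = 0\<close> a show False
          by (auto simp: A_def R2'_def prod_eq_iff)
      qed
    qed (auto simp: A_def R2'_def)
  qed
  then show ?thesis
    by (simp add: A_def)
qed

end

section \<open>The fourth moment\<close>

context odd_paraboloid
begin

lemma orth_ip:
  assumes "a \<in> R2" "b \<in> R2"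
  shows "(\<Sum>x\<in>R2. e (ip x a) * cnj (e (ip x b))) = (if a = b then of_real (real p ^ 2) else 0)"
proof -
  have "(\<Sum>x\<in>R2. e (ip x a) * cnj (e (ip x b))) =
      (if int p dvd fst a - fst b \<and> int p dvd snd a - snd b then of_nat (p ^ 2) else 0)"
    using orth2 [of "fst a" "snd a" "fst b" "snd b"] by (simp add: ip_def case_prod_beta)
  then show ?thesis
    using R2_eqI [OF assms] by auto
qed

end

locale slices = odd_paraboloid +
  fixes E :: "int \<Rightarrow> (int \<times> int) set" and g :: "int \<Rightarrow> int \<times> int \<Rightarrow> complex"
  assumes E_subset: "E z \<subseteq> R2"
    and norm_g: "y \<in> E z \<Longrightarrow> norm (g z y) = 1"
begin

definition N :: real where
  "N = (\<Sum>z\<in>R. real (card (E z)))"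

definition c :: "int \<Rightarrow> real" where
  "c z = 1 / card (E z)"

text \<open>The Fourier transform of \<open>g z\<close>, placed on the slice at height
  \<open>z\<close>, at the point of the paraboloid above \<open>\<xi>\<close>.\<close>

definition F :: "int \<Rightarrow> int \<times> int \<Rightarrow> complex" where
  "F z \<xi> = (\<Sum>y\<in>E z. g z y * e (- (ip y \<xi> + z * ip \<xi> \<xi>)))"

text \<open>Unnormalised: at time \<open>t = z\<close>, for \<open>x\<close> in \<open>R2\<close>,
  it is \<open>p ^ 2\<close> times \<open>g z x\<close> on the slice and \<open>0\<close> off
  it.\<close>

definition U :: "int \<Rightarrow> int \<times> int \<Rightarrow> int \<Rightarrow> complex" where
  "U z x t = (\<Sum>\<xi>\<in>R2. F z \<xi> * e (ip x \<xi> + t * ip \<xi> \<xi>))"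

text \<open>The weights \<open>c z\<close> make each slice contribute one unit of mass, so no pigeonholing in the slice
  sizes is needed.\<close>

definition density :: "int \<times> int \<Rightarrow> int \<Rightarrow> real" where
  "density x t = (\<Sum>z\<in>R. c z * (norm (U z x t))\<^sup>2)"

definition J :: "int \<times> int \<Rightarrow> int \<times> int \<Rightarrow> complex" where
  "J \<xi> \<eta> = (\<Sum>z\<in>R. of_real (c z) * (F z \<xi> * cnj (F z \<eta>)))"

definition mode :: "int \<Rightarrow> int \<times> int \<Rightarrow> complex" where
  "mode t a = (\<Sum>\<xi>\<in>R2. J (\<xi> + a) \<xi> * e (t * (2 * ip \<xi> a + ip a a)))"

text \<open>The partial trace of \<open>J\<close> across the direction \<open>a\<close>.\<close>

definition K :: "int \<times> int \<Rightarrow> int \<Rightarrow> int \<Rightarrow> complex" where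
  "K a s s' = (\<Sum>w\<in>R. J (frame a s w) (frame a s' w))"

text \<open>A weighted count of the pairs in a common slice whose difference is parallel to
  \<open>a\<close>; it is \<open>lines\<close> for the direction \<open>a\<close>.\<close>

definition collinear :: "int \<times> int \<Rightarrow> real" where
  "collinear a = (\<Sum>z\<in>R. c z * (\<Sum>l\<in>R. (real (card {y \<in> E z. ip y (perp a) mod int p = l}))\<^sup>2))"

lemma finite_E [simp]: "finite (E z)"
  using E_subset by (rule finite_subset) simp

lemma c_nonneg [simp]: "c z \<ge> 0"
  by (simp add: c_def)

lemma N_nonneg: "N \<ge> 0"
  by (simp add: N_def sum_nonneg)

lemma F_cong: "red \<xi> = red \<eta> \<Longrightarrow> F z \<xi> = F z \<eta>"
  unfolding F_def red_def prod.inject ip_def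
  by (intro sum.cong refl arg_cong2 [where f = "(*)"] e_cong mod_minus_cong mod_add_cong mod_mult_cong)
    auto

lemma F_red [simp]: "F z (red \<xi>) = F z \<xi>"
  by (rule F_cong) (simp add: red_def)

lemma J_cong: "red \<xi> = red \<xi>' \<Longrightarrow> red \<eta> = red \<eta>' \<Longrightarrow> J \<xi> \<eta> = J \<xi>' \<eta>'"
  unfolding J_def using F_cong by metis

lemma K_cong:
  assumes "red a = red b" "s mod int p = u mod int p" "s' mod int p = v mod int p"
  shows "K a s s' = K b u v"
proof -
  have "red (frame a s w) = red (frame b u w)" if "s mod int p = u mod int p" for s u w
    using assms(1) that unfolding red_def vec_defs
    by (simp, intro conjI mod_add_cong mod_diff_cong mod_mult_cong refl; simp)
  then show ?thesis
    unfolding K_def using assms by (intro sum.cong refl J_cong) auto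
qed

section \<open>Fourier modes of the density\<close>

text \<open>After the square is opened and one variable shifted by \<open>a\<close>, the quadratic
  phases cancel up to \<open>2 * ip \<xi> a + ip a a\<close>, which is affine in
  \<open>\<xi>\<close>.\<close>

lemma norm_U_squared:
  "of_real ((norm (U z x t))\<^sup>2) =
    (\<Sum>a\<in>R2. (\<Sum>\<xi>\<in>R2. F z (\<xi> + a) * cnj (F z \<xi>) * e (t * (2 * ip \<xi> a + ip a a))) * e (ip x a))"
proof -
  define h where "h \<xi> = F z \<xi> * e (ip x \<xi> + t * ip \<xi> \<xi>)" for \<xi>
  have h: "h (red \<xi>) = h \<xi>" for \<xi>
  proof -
    have "e (ip x (red \<xi>) + t * ip (red \<xi>) (red \<xi>)) = e (ip x \<xi> + t * ip \<xi> \<xi>)"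
      by (rule e_cong) (unfold ip_def red_def, simp, intro mod_add_cong mod_mult_cong refl; simp)
    then show ?thesis
      by (simp add: h_def)
  qed
  have "of_real ((norm (U z x t))\<^sup>2) = (\<Sum>\<eta>\<in>R2. h \<eta>) * (\<Sum>\<xi>\<in>R2. cnj (h \<xi>))"
    by (simp only: complex_norm_square U_def h_def cnj_sum)
  also have "\<dots> = (\<Sum>\<xi>\<in>R2. (\<Sum>\<eta>\<in>R2. h \<eta>) * cnj (h \<xi>))"
    by (rule sum_distrib_left)
  also have "\<dots> = (\<Sum>\<xi>\<in>R2. (\<Sum>a\<in>R2. h (a + \<xi>)) * cnj (h \<xi>))"
    by (simp only: sum_R2_shift [of h, OF h])
  also have "\<dots> = (\<Sum>a\<in>R2. \<Sum>\<xi>\<in>R2. h (a + \<xi>) * cnj (h \<xi>))"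
    unfolding sum_distrib_right by (rule sum.swap)
  also have "\<dots> = (\<Sum>a\<in>R2. (\<Sum>\<xi>\<in>R2. F z (\<xi> + a) * cnj (F z \<xi>) * e (t * (2 * ip \<xi> a + ip a a))) * e (ip x a))"
  proof -
    have "h (a + \<xi>) * cnj (h \<xi>) = F z (\<xi> + a) * cnj (F z \<xi>) * e (t * (2 * ip \<xi> a + ip a a)) * e (ip x a)" for a \<xi>
    proof -
      have "e (ip x (a + \<xi>) + t * ip (a + \<xi>) (a + \<xi>)) * cnj (e (ip x \<xi> + t * ip \<xi> \<xi>)) =
          e (t * (2 * ip \<xi> a + ip a a)) * e (ip x a)"
        unfolding e_diff [symmetric] e_add [symmetric]
        by (rule arg_cong [of _ _ e]) (simp add: ip_def algebra_simps)
      then show ?thesis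
        by (simp add: h_def add.commute mult_ac)
    qed
    then show ?thesis
      by (simp add: sum_distrib_right)
  qed
  finally show ?thesis .
qed

lemma density_modes: "complex_of_real (density x t) = (\<Sum>a\<in>R2. mode t a * e (ip x a))"
proof -
  have "complex_of_real (density x t) = (\<Sum>z\<in>R. \<Sum>a\<in>R2. \<Sum>\<xi>\<in>R2.
      of_real (c z) * (F z (\<xi> + a) * cnj (F z \<xi>)) * (e (t * (2 * ip \<xi> a + ip a a)) * e (ip x a)))"
    unfolding density_def of_real_sum of_real_mult norm_U_squared sum_distrib_left sum_distrib_right
    by (simp only: mult.assoc)
  also have "\<dots> = (\<Sum>a\<in>R2. \<Sum>\<xi>\<in>R2. \<Sum>z\<in>R.
      of_real (c z) * (F z (\<xi> + a) * cnj (F z \<xi>)) * (e (t * (2 * ip \<xi> a + ip a a)) * e (ip x a)))"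
    by (subst sum.swap) (intro sum.cong refl sum.swap)
  also have "\<dots> = (\<Sum>a\<in>R2. mode t a * e (ip x a))"
    unfolding mode_def J_def sum_distrib_right by (simp only: mult.assoc)
  finally show ?thesis .
qed

lemma sum_density_squared: "(\<Sum>x\<in>R2. (density x t)\<^sup>2) = real p ^ 2 * (\<Sum>a\<in>R2. (norm (mode t a))\<^sup>2)"
proof -
  have "(density x t)\<^sup>2 = (norm (\<Sum>a\<in>R2. mode t a * e (ip x a)))\<^sup>2" for x
    unfolding density_modes [symmetric] by simp
  then have "(\<Sum>x\<in>R2. (density x t)\<^sup>2) = (\<Sum>x\<in>R2. (norm (\<Sum>a\<in>R2. mode t a * e (ip x a)))\<^sup>2)"
    by simp
  also have "\<dots> = real p ^ 2 * (\<Sum>a\<in>R2. (norm (mode t a))\<^sup>2)"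
    by (rule sum_norm_parseval) (simp, rule orth_ip)
  finally show ?thesis .
qed

lemma sum_norm_F: "(\<Sum>\<xi>\<in>R2. (norm (F z \<xi>))\<^sup>2) = real p ^ 2 * card (E z)"
proof -
  have "norm (F z \<xi>) = norm (\<Sum>y\<in>E z. cnj (g z y) * e (ip \<xi> y))" for \<xi>
  proof -
    have "F z \<xi> = e (- (z * ip \<xi> \<xi>)) * cnj (\<Sum>y\<in>E z. cnj (g z y) * e (ip \<xi> y))"
      unfolding F_def cnj_sum sum_distrib_left
    proof (intro sum.cong refl)
      fix y
      have "e (- (ip y \<xi> + z * ip \<xi> \<xi>)) = e (- (z * ip \<xi> \<xi>)) * e (- ip \<xi> y)"
        unfolding e_add [symmetric] by (simp add: ip_def algebra_simps)
      then show "g z y * e (- (ip y \<xi> + z * ip \<xi> \<xi>)) = e (- (z * ip \<xi> \<xi>)) * cnj (cnj (g z y) * e (ip \<xi> y))"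
        by (simp add: e_minus)
    qed
    then show ?thesis
      by (simp only: norm_mult norm_e complex_mod_cnj mult_1)
  qed
  then have "(\<Sum>\<xi>\<in>R2. (norm (F z \<xi>))\<^sup>2) = (\<Sum>\<xi>\<in>R2. (norm (\<Sum>y\<in>E z. cnj (g z y) * e (ip \<xi> y)))\<^sup>2)"
    by simp
  also have "\<dots> = real p ^ 2 * (\<Sum>y\<in>E z. (norm (cnj (g z y)))\<^sup>2)"
  proof (rule sum_norm_parseval)
    fix i j assume "i \<in> E z" "j \<in> E z"
    then show "(\<Sum>x\<in>R2. e (ip x i) * cnj (e (ip x j))) = (if i = j then complex_of_real (real p ^ 2) else 0)"
      using E_subset by (intro orth_ip) auto
  qed simp
  also have "(\<Sum>y\<in>E z. (norm (cnj (g z y)))\<^sup>2) = card (E z)"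
    by (simp add: norm_g)
  finally show ?thesis .
qed

text \<open>The zero mode is the total mass: by the choice of \<open>c z\<close> each of the at most
  \<open>p\<close> nonempty slices contributes \<open>p ^ 2\<close>.\<close>

lemma norm_mode_0: "norm (mode t 0) \<le> real p ^ 3"
proof -
  have "mode t 0 = (\<Sum>\<xi>\<in>R2. \<Sum>z\<in>R. of_real (c z * (norm (F z \<xi>))\<^sup>2))"
    unfolding mode_def J_def of_real_mult complex_norm_square by (simp add: ip_def)
  also have "\<dots> = of_real (\<Sum>z\<in>R. c z * (\<Sum>\<xi>\<in>R2. (norm (F z \<xi>))\<^sup>2))"
    by (subst sum.swap) (simp only: of_real_sum sum_distrib_left)
  finally have "norm (mode t 0) = \<bar>\<Sum>z\<in>R. c z * (real p ^ 2 * card (E z))\<bar>"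
    by (simp only: norm_of_real sum_norm_F)
  also have "\<dots> \<le> (\<Sum>z\<in>R. real p ^ 2)"
    by (rule order.trans [OF sum_abs], rule sum_mono) (simp add: c_def)
  finally show ?thesis
    by (simp add: power2_eq_square power3_eq_cube mult_ac)
qed

text \<open>In the frame of \<open>a\<close> the phase depends only on the coordinate
  \<open>s\<close> along \<open>a\<close>, and adding \<open>a\<close> raises \<open>s\<close> by
  one. Hence the mode is a Fourier sum in \<open>t\<close> of the entries
  \<open>K a (s + 1) s\<close>, with distinct frequencies \<open>2 * s * n\<close>, and Plancherel
  in \<open>t\<close> applies.\<close>

lemma sum_norm_mode:
  assumes "a \<in> R2'"
  shows "(\<Sum>t\<in>R. (norm (mode t a))\<^sup>2) = p * (\<Sum>s\<in>R. (norm (K a (s + 1) s))\<^sup>2)"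
proof -
  define n where "n = ip a a"
  have n: "\<not> int p dvd n"
    using ip_self_unit [OF assms] by (simp add: n_def)
  have mode: "norm (mode t a) = norm (\<Sum>s\<in>R. K a (s + 1) s * e (t * (2 * s * n)))" for t
  proof -
    define h where "h \<xi> = J (\<xi> + a) \<xi> * e (t * (2 * ip \<xi> a + n))" for \<xi>
    have h: "h (red \<xi>) = h \<xi>" for \<xi>
    proof -
      have "e (t * (2 * ip (red \<xi>) a + n)) = e (t * (2 * ip \<xi> a + n))"
        by (rule e_cong) (unfold ip_def red_def, simp, intro mod_add_cong mod_mult_cong refl; simp)
      moreover have "J (red \<xi> + a) (red \<xi>) = J (\<xi> + a) \<xi>"
        by (rule J_cong) (simp_all add: red_def mod_simps)
      ultimately show ?thesis
        by (simp add: h_def)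
    qed
    have "mode t a = (\<Sum>\<xi>\<in>R2. h \<xi>)"
      by (simp add: mode_def h_def n_def)
    also have "\<dots> = (\<Sum>(s, w)\<in>R2. h (frame a s w))"
      using h assms by (rule sum_R2_frame [symmetric])
    also have "\<dots> = (\<Sum>s\<in>R. \<Sum>w\<in>R. h (frame a s w))"
      by (simp add: sum.cartesian_product)
    also have "\<dots> = (\<Sum>s\<in>R. e (t * n) * (K a (s + 1) s * e (t * (2 * s * n))))"
    proof (rule sum.cong [OF refl])
      fix s
      have "e (t * (2 * (s * n) + n)) = e (t * n) * e (t * (2 * s * n))"
        unfolding e_add [symmetric] by (rule arg_cong [of _ _ e]) (simp add: algebra_simps)
      then have "h (frame a s w) = J (frame a (s + 1) w) (frame a s w) * (e (t * n) * e (t * (2 * s * n)))" for w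
        by (simp only: h_def frame_add ip_frame_base n_def [symmetric])
      then show "(\<Sum>w\<in>R. h (frame a s w)) = e (t * n) * (K a (s + 1) s * e (t * (2 * s * n)))"
        by (simp only: K_def sum_distrib_left sum_distrib_right mult_ac)
    qed
    also have "\<dots> = e (t * n) * (\<Sum>s\<in>R. K a (s + 1) s * e (t * (2 * s * n)))"
      by (rule sum_distrib_left [symmetric])
    finally show ?thesis
      by (simp add: norm_mult)
  qed
  have "(\<Sum>t\<in>R. (norm (mode t a))\<^sup>2) = (\<Sum>t\<in>R. (norm (\<Sum>s\<in>R. K a (s + 1) s * e (t * (2 * s * n))))\<^sup>2)"
    by (simp add: mode)
  also have "\<dots> = p * (\<Sum>s\<in>R. (norm (K a (s + 1) s))\<^sup>2)"
  proof (rule sum_norm_parseval)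
    fix i j assume ij: "i \<in> R" "j \<in> R"
    have "i = j" if "int p dvd 2 * i * n - 2 * j * n"
    proof -
      have "2 * i * n - 2 * j * n = 2 * (n * (i - j))"
        by (simp add: algebra_simps)
      then have "int p dvd n * (i - j)"
        using that two_dvd_cancel by metis
      then show ?thesis
        using n prime_dvd_multE R_eqI ij by blast
    qed
    then show "(\<Sum>t\<in>R. e (t * (2 * i * n)) * cnj (e (t * (2 * j * n)))) = (if i = j then complex_of_real (real p) else 0)"
      unfolding orth1 by auto
  qed simp
  finally show ?thesis .
qed

text \<open>In frame coordinates \<open>F\<close> is a Fourier sum in \<open>w\<close> over the
  lines with coefficients \<open>D.V z l s\<close>, up to a phase independent of \<open>s\<close>.
  That phase cancels in \<open>J\<close>, so Plancherel in \<open>w\<close> gives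
  \<open>K a = p * D.M\<close>, and \<open>D.offdiag_le\<close> applies.\<close>

lemma K_offdiag_le:
  assumes "a \<in> R2'"
  shows "(\<Sum>(s, s')\<in>Off. (norm (K a s s'))\<^sup>2) \<le> 3 * real p ^ 4 * collinear a"
proof -
  define n where "n = ip a a"
  interpret D: direction p E g "\<lambda>y. ip y a" "\<lambda>y. ip y (perp a)" n
  proof
    fix y y' z assume y: "y \<in> E z" "y' \<in> E z" "int p dvd ip y a - ip y' a" "int p dvd ip y (perp a) - ip y' (perp a)"
    then have "int p dvd ip (y - y') a" "int p dvd ip (y - y') (perp a)"
      by (simp_all add: vec_defs algebra_simps)
    then have "int p dvd fst (y - y')" "int p dvd snd (y - y')"
      using frame_coords_dvd [OF assms] by blast+
    then show "y = y'"
      using y E_subset by (intro R2_eqI) auto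
  qed (use ip_self_unit [OF assms] norm_g in \<open>simp_all add: n_def\<close>)
  have F: "F z (frame a s w) = e (- (z * n * w\<^sup>2)) * (\<Sum>l\<in>R. D.V z l s * e (w * - l))" for z s w
  proof -
    have "(\<Sum>l\<in>R. D.V z l s * e (w * - l)) = (\<Sum>l\<in>R. \<Sum>y\<in>D.fibre z l. g z y * (D.chirp z (ip y a) s * e (w * - l)))"
      by (simp add: D.V_def sum_distrib_right mult.assoc)
    also have "\<dots> = (\<Sum>y\<in>E z. g z y * (D.chirp z (ip y a) s * e (w * - (ip y (perp a) mod int p))))"
      by (rule D.sum_fibres)
    also have "\<dots> = (\<Sum>y\<in>E z. g z y * (D.chirp z (ip y a) s * e (w * - ip y (perp a))))"
    proof -
      have "e (w * - (l mod int p)) = e (w * - l)" for l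
        by (rule e_cong) (intro mod_mult_cong refl, metis mod_minus_cong mod_mod_trivial)
      then show ?thesis
        by simp
    qed
    finally have "(\<Sum>l\<in>R. D.V z l s * e (w * - l)) = (\<Sum>y\<in>E z. g z y * (D.chirp z (ip y a) s * e (w * - ip y (perp a))))" .
    moreover have "e (- (ip y (frame a s w) + z * ip (frame a s w) (frame a s w))) =
        e (- (z * n * w\<^sup>2)) * (D.chirp z (ip y a) s * e (w * - ip y (perp a)))" for y
      unfolding D.chirp_def e_add [symmetric] ip_frame_frame n_def [symmetric]
      unfolding ip_frame by (rule arg_cong [of _ _ e]) (simp add: algebra_simps)
    ultimately show ?thesis
      by (simp add: F_def sum_distrib_left mult.left_commute)
  qed
  have K: "K a s s' = of_nat p * D.M s s'" for s s'
  proof -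
    have "(\<Sum>w\<in>R. F z (frame a s w) * cnj (F z (frame a s' w))) =
        of_nat p * (\<Sum>l\<in>R. D.V z l s * cnj (D.V z l s'))" for z
    proof -
      have "(\<Sum>w\<in>R. F z (frame a s w) * cnj (F z (frame a s' w))) =
          (\<Sum>w\<in>R. (\<Sum>l\<in>R. D.V z l s * e (w * - l)) * cnj (\<Sum>l\<in>R. D.V z l s' * e (w * - l)))"
        (is "_ = (\<Sum>w\<in>R. ?f w * cnj (?g w))")
      proof (rule sum.cong [OF refl])
        fix w
        have "F z (frame a s w) * cnj (F z (frame a s' w)) =
            (e (- (z * n * w\<^sup>2)) * cnj (e (- (z * n * w\<^sup>2)))) * (?f w * cnj (?g w))"
          unfolding F complex_cnj_mult by (simp only: mult_ac)
        then show "F z (frame a s w) * cnj (F z (frame a s' w)) = ?f w * cnj (?g w)"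
          by simp
      qed
      also have "\<dots> = of_nat p * (\<Sum>l\<in>R. D.V z l s * cnj (D.V z l s'))"
      proof (rule sum_parseval)
        fix i j assume "i \<in> R" "j \<in> R"
        then have "int p dvd - i - - j \<Longrightarrow> i = j"
          using R_eqI [of j i] by simp
        then show "(\<Sum>w\<in>R. e (w * - i) * cnj (e (w * - j))) = (if i = j then of_nat p else 0)"
          unfolding orth1 by auto
      qed simp
      finally show ?thesis .
    qed
    note * = this
    have "K a s s' = (\<Sum>z\<in>R. of_real (c z) * (\<Sum>w\<in>R. F z (frame a s w) * cnj (F z (frame a s' w))))"
      unfolding K_def J_def sum_distrib_left by (rule sum.swap)
    also have "\<dots> = of_nat p * D.M s s'"
      by (simp add: * D.M_def sum.cartesian_product [symmetric] sum_distrib_left c_def D.c_def mult.left_commute)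
    finally show ?thesis .
  qed
  have "(\<Sum>(s, s')\<in>Off. (norm (K a s s'))\<^sup>2) = real p ^ 2 * D.offdiag"
    by (simp add: K D.offdiag_def norm_mult power_mult_distrib sum_distrib_left case_prod_beta)
  also have "\<dots> \<le> real p ^ 2 * (3 * real p ^ 2 * D.lines)"
    by (intro mult_left_mono D.offdiag_le) simp
  also have "D.lines = collinear a"
    by (simp add: D.lines_def collinear_def D.c_def c_def D.fibre_def)
  finally show ?thesis
    by (simp add: power2_eq_square power4_eq_xxxx mult_ac)
qed

text \<open>\<open>K (scale r a) s s' = K a (r s) (r s')\<close>, so averaging over the scaling \<open>r\<close> turns the pairs at
  distance one into all off-diagonal pairs.\<close>

lemma sum_K_step:
  "(real p - 1) * (\<Sum>a\<in>R2'. \<Sum>s\<in>R. (norm (K a (s + 1) s))\<^sup>2) =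
    (\<Sum>a\<in>R2'. \<Sum>(s, s')\<in>Off. (norm (K a s s'))\<^sup>2)"
proof -
  let ?Q = "\<Sum>a\<in>R2'. \<Sum>s\<in>R. (norm (K a (s + 1) s))\<^sup>2"
  have step: "(\<Sum>a\<in>R2'. \<Sum>s\<in>R. (norm (K a (s + r) s))\<^sup>2) = ?Q" if "r \<in> R - {0}" for r
  proof -
    have r: "\<not> int p dvd r"
      using that R_eqI [of r 0] by auto
    \<comment> \<open>The cross coordinate \<open>w\<close> runs over all residues, so the factor
      \<open>r\<close> on it is absorbed by reindexing.\<close>
    have K_scale: "K (scale r a) s s' = K a (r * s) (r * s')" for a s s'
    proof -
      have "(\<Sum>w\<in>R. J (frame a (r * s) (r * w)) (frame a (r * s') (r * w))) =
          (\<Sum>w\<in>R. J (frame a (r * s) w) (frame a (r * s') w))"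
      proof (rule sum_R_scale [OF _ r])
        have "red (frame a s (w mod int p)) = red (frame a s w)" for s w
          unfolding red_def vec_defs by (simp, intro conjI mod_add_cong mod_diff_cong mod_mult_cong refl; simp)
        then show "J (frame a (r * s) (u mod int p)) (frame a (r * s') (u mod int p)) =
            J (frame a (r * s) u) (frame a (r * s') u)" for u
          by (intro J_cong) auto
      qed
      then show ?thesis
        by (simp add: K_def frame_scale)
    qed
    have "?Q = (\<Sum>a\<in>R2'. \<Sum>s\<in>R. (norm (K (scale r a) (s + 1) s))\<^sup>2)"
    proof (rule sum_R2'_scale [OF _ r, symmetric])
      fix u
      have "K (red u) s s' = K u s s'" for s s'
        by (rule K_cong) (simp_all add: red_def)
      then show "(\<Sum>s\<in>R. (norm (K (red u) (s + 1) s))\<^sup>2) = (\<Sum>s\<in>R. (norm (K u (s + 1) s))\<^sup>2)"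
        by simp
    qed
    also have "\<dots> = (\<Sum>a\<in>R2'. \<Sum>s\<in>R. (norm (K a (r * s + r) (r * s)))\<^sup>2)"
      by (simp add: K_scale distrib_left)
    also have "\<dots> = (\<Sum>a\<in>R2'. \<Sum>s\<in>R. (norm (K a (s + r) s))\<^sup>2)"
    proof (rule sum.cong [OF refl], rule sum_R_scale [OF _ r])
      fix a u
      have "K a (u mod int p + r) (u mod int p) = K a (u + r) u"
        by (rule K_cong) (simp_all add: mod_simps)
      then show "(norm (K a (u mod int p + r) (u mod int p)))\<^sup>2 = (norm (K a (u + r) u))\<^sup>2"
        by simp
    qed
    finally show ?thesis ..
  qed
  \<comment> \<open>The difference \<open>r\<close> of the two indices runs over the nonzero
    residues; \<open>r = 0\<close> is the diagonal.\<close>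
  have off: "(\<Sum>r\<in>R - {0}. \<Sum>s\<in>R. (norm (K a (s + r) s))\<^sup>2) = (\<Sum>(s, s')\<in>Off. (norm (K a s s'))\<^sup>2)" for a
  proof -
    have "(\<Sum>r\<in>R. \<Sum>s\<in>R. (norm (K a (s + r) s))\<^sup>2) = (\<Sum>s\<in>R. \<Sum>r\<in>R. (norm (K a (r + s) s))\<^sup>2)"
      by (subst sum.swap) (simp add: add.commute)
    also have "\<dots> = (\<Sum>s\<in>R. \<Sum>u\<in>R. (norm (K a u s))\<^sup>2)"
    proof (rule sum.cong [OF refl], rule sum_R_shift)
      fix s u
      have "K a (u mod int p) s = K a u s"
        by (rule K_cong) simp_all
      then show "(norm (K a (u mod int p) s))\<^sup>2 = (norm (K a u s))\<^sup>2"
        by simp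
    qed
    also have "\<dots> = (\<Sum>u\<in>R. \<Sum>s\<in>R. (norm (K a u s))\<^sup>2)"
      by (rule sum.swap)
    also have "\<dots> = (\<Sum>s\<in>R. (norm (K a s s))\<^sup>2) + (\<Sum>(s, s')\<in>Off. (norm (K a s s'))\<^sup>2)"
      by (rule sum_diag_off)
    finally show ?thesis
      by (subst sum_diff1) simp_all
  qed
  have "(real p - 1) * ?Q = (\<Sum>r\<in>R - {0}. ?Q)"
    using p_ge_3 by (simp add: card_Diff_singleton of_nat_diff)
  also have "\<dots> = (\<Sum>r\<in>R - {0}. \<Sum>a\<in>R2'. \<Sum>s\<in>R. (norm (K a (s + r) s))\<^sup>2)"
    by (intro sum.cong refl step [symmetric])
  also have "\<dots> = (\<Sum>a\<in>R2'. \<Sum>r\<in>R - {0}. \<Sum>s\<in>R. (norm (K a (s + r) s))\<^sup>2)"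
    by (rule sum.swap)
  finally show ?thesis
    by (simp add: off)
qed

section \<open>Collinear pairs and the fourth moment bound\<close>

text \<open>A pair \<open>y = y'\<close> is counted in all \<open>p ^ 2 - 1\<close> directions, a
  pair of distinct points in at most \<open>p - 1\<close>. Dividing by the slice size leaves
  \<open>(p - 1) * (card (E z) + p)\<close> per slice.\<close>

lemma sum_collinear_le: "(\<Sum>a\<in>R2'. collinear a) \<le> (real p - 1) * (N + real p ^ 2)"
proof -
  let ?same = "\<lambda>y y' a. ip y (perp a) mod int p = ip y' (perp a) mod int p"
  have sq: "(\<Sum>l\<in>R. (real (card {y \<in> E z. ip y (perp a) mod int p = l}))\<^sup>2) =
      (\<Sum>y\<in>E z. \<Sum>y'\<in>E z. of_bool (?same y y' a))" for a z
  proof -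
    have "(real (card {y \<in> E z. ip y (perp a) mod int p = l}))\<^sup>2 =
        (\<Sum>y\<in>{y \<in> E z. ip y (perp a) mod int p = l}. \<Sum>y'\<in>E z. of_bool (?same y y' a))" for l
    proof -
      have "(\<Sum>y'\<in>E z. of_bool (?same y y' a)) = real (card {y \<in> E z. ip y (perp a) mod int p = l})"
        if "ip y (perp a) mod int p = l" for y
      proof -
        have "{y' \<in> E z. ?same y y' a} = {y \<in> E z. ip y (perp a) mod int p = l}"
          using that by auto
        then show ?thesis
          by (simp add: of_bool_def sum.If_cases Int_def)
      qed
      then have "(\<Sum>y\<in>{y \<in> E z. ip y (perp a) mod int p = l}. \<Sum>y'\<in>E z. of_bool (?same y y' a)) =
          (\<Sum>y\<in>{y \<in> E z. ip y (perp a) mod int p = l}. real (card {y \<in> E z. ip y (perp a) mod int p = l}))"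
        by (intro sum.cong refl) blast
      then show ?thesis
        by (simp only: sum_constant power2_eq_square)
    qed
    then have "(\<Sum>l\<in>R. (real (card {y \<in> E z. ip y (perp a) mod int p = l}))\<^sup>2) =
        (\<Sum>l\<in>R. \<Sum>y\<in>{y \<in> E z. ip y (perp a) mod int p = l}. \<Sum>y'\<in>E z. of_bool (?same y y' a))"
      by simp
    also have "\<dots> = (\<Sum>y\<in>E z. \<Sum>y'\<in>E z. of_bool (?same y y' a))"
      by (rule sum.group) auto
    finally show ?thesis .
  qed
  have card_R2': "real (card R2') = real p ^ 2 - 1"
    using p_ge_3 by (simp add: R2'_def card_Diff_singleton of_nat_diff power2_eq_square)
  have pair: "(\<Sum>a\<in>R2'. of_bool (?same y y' a)) \<le> (real p - 1) * (1 + (if y = y' then real p else 0))"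
    if "y \<in> E z" "y' \<in> E z" for y y' z
  proof (cases "y = y'")
    case True
    then show ?thesis
      using card_R2' by (simp add: power2_eq_square algebra_simps)
  next
    case False
    have "(\<Sum>a\<in>R2'. of_bool (?same y y' a)) = real (card {a \<in> R2'. ?same y y' a})"
      by (simp add: of_bool_def sum.If_cases Int_def)
    also have "\<dots> \<le> real (p - 1)"
      using card_perp_le [of y y'] False that E_subset by (intro of_nat_mono) blast
    finally show ?thesis
      using False p_ge_3 by (simp add: of_nat_diff)
  qed
  have slice: "c z * (\<Sum>y\<in>E z. \<Sum>y'\<in>E z. \<Sum>a\<in>R2'. of_bool (?same y y' a)) \<le> (real p - 1) * (card (E z) + real p)" for z
  proof -
    have "(\<Sum>y\<in>E z. \<Sum>y'\<in>E z. \<Sum>a\<in>R2'. of_bool (?same y y' a)) \<le>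
        (\<Sum>y\<in>E z. \<Sum>y'\<in>E z. (real p - 1) * (1 + (if y = y' then real p else 0)))"
      by (intro sum_mono pair)
    also have "\<dots> = card (E z) * ((real p - 1) * (card (E z) + real p))"
      by (simp add: sum_distrib_left [symmetric] sum.distrib)
    finally have "c z * (\<Sum>y\<in>E z. \<Sum>y'\<in>E z. \<Sum>a\<in>R2'. of_bool (?same y y' a)) \<le>
        c z * (card (E z) * ((real p - 1) * (card (E z) + real p)))"
      by (rule mult_left_mono) simp
    also have "\<dots> \<le> (real p - 1) * (card (E z) + real p)"
      using p_ge_3 by (cases "E z = {}") (simp_all add: c_def)
    finally show ?thesis .
  qed
  have swap: "(\<Sum>a\<in>R2'. \<Sum>y\<in>E z. \<Sum>y'\<in>E z. of_bool (?same y y' a)) =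
      (\<Sum>y\<in>E z. \<Sum>y'\<in>E z. \<Sum>a\<in>R2'. (of_bool (?same y y' a) :: real))" for z
    by (subst sum.swap) (intro sum.cong refl sum.swap)
  have "(\<Sum>a\<in>R2'. collinear a) = (\<Sum>a\<in>R2'. \<Sum>z\<in>R. c z * (\<Sum>y\<in>E z. \<Sum>y'\<in>E z. of_bool (?same y y' a)))"
    by (simp only: collinear_def sq)
  also have "\<dots> = (\<Sum>z\<in>R. c z * (\<Sum>a\<in>R2'. \<Sum>y\<in>E z. \<Sum>y'\<in>E z. of_bool (?same y y' a)))"
    unfolding sum_distrib_left by (rule sum.swap)
  also have "\<dots> = (\<Sum>z\<in>R. c z * (\<Sum>y\<in>E z. \<Sum>y'\<in>E z. \<Sum>a\<in>R2'. of_bool (?same y y' a)))"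
    by (simp only: swap)
  also have "\<dots> \<le> (\<Sum>z\<in>R. (real p - 1) * (card (E z) + real p))"
    by (intro sum_mono slice)
  also have "\<dots> = (real p - 1) * (N + real p ^ 2)"
    by (simp add: sum_distrib_left [symmetric] sum.distrib N_def power2_eq_square)
  finally show ?thesis .
qed

text \<open>The zero modes give \<open>p ^ 9\<close>. For the others the factor \<open>p - 1\<close>
  of \<open>sum_K_step\<close> cancels that of \<open>sum_collinear_le\<close>, which leaves
  \<open>3 * p ^ 7 * (N + p ^ 2)\<close>.\<close>

lemma sum_density_le: "(\<Sum>t\<in>R. \<Sum>x\<in>R2. (density x t)\<^sup>2) \<le> real p ^ 7 * (4 * real p ^ 2 + 3 * N)"
proof -
  let ?Q = "\<Sum>a\<in>R2'. \<Sum>s\<in>R. (norm (K a (s + 1) s))\<^sup>2"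
  have "(real p - 1) * ?Q \<le> (\<Sum>a\<in>R2'. 3 * real p ^ 4 * collinear a)"
    unfolding sum_K_step by (intro sum_mono K_offdiag_le)
  also have "\<dots> \<le> 3 * real p ^ 4 * ((real p - 1) * (N + real p ^ 2))"
    unfolding sum_distrib_left [symmetric] by (intro mult_left_mono sum_collinear_le) simp
  finally have "(real p - 1) * ?Q \<le> (real p - 1) * (3 * real p ^ 4 * (N + real p ^ 2))"
    by (simp only: mult_ac)
  then have Q: "?Q \<le> 3 * real p ^ 4 * (N + real p ^ 2)"
    using p_ge_3 by (subst (asm) mult_le_cancel_left_pos) simp_all
  have "(\<Sum>t\<in>R. \<Sum>x\<in>R2. (density x t)\<^sup>2) = real p ^ 2 * (\<Sum>t\<in>R. \<Sum>a\<in>R2. (norm (mode t a))\<^sup>2)"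
    by (simp only: sum_density_squared sum_distrib_left)
  also have "(\<Sum>t\<in>R. \<Sum>a\<in>R2. (norm (mode t a))\<^sup>2) = (\<Sum>t\<in>R. (norm (mode t 0))\<^sup>2 + (\<Sum>a\<in>R2'. (norm (mode t a))\<^sup>2))"
    unfolding R2'_def by (intro sum.cong refl sum.remove) simp_all
  also have "\<dots> = (\<Sum>t\<in>R. (norm (mode t 0))\<^sup>2) + (\<Sum>a\<in>R2'. \<Sum>t\<in>R. (norm (mode t a))\<^sup>2)"
    unfolding sum.distrib by (simp only: sum.swap [of _ R2' R])
  also have "(\<Sum>a\<in>R2'. \<Sum>t\<in>R. (norm (mode t a))\<^sup>2) = p * ?Q"
    by (simp add: sum_norm_mode sum_distrib_left)
  also have "(\<Sum>t\<in>R. (norm (mode t 0))\<^sup>2) \<le> (\<Sum>t\<in>R. (real p ^ 3)\<^sup>2)"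
    by (intro sum_mono power_mono norm_mode_0) simp
  finally have "(\<Sum>t\<in>R. \<Sum>x\<in>R2. (density x t)\<^sup>2) \<le> real p ^ 2 * ((\<Sum>t\<in>R. (real p ^ 3)\<^sup>2) + p * ?Q)"
    by (simp add: mult_left_mono)
  also have "\<dots> \<le> real p ^ 2 * ((\<Sum>t\<in>R. (real p ^ 3)\<^sup>2) + p * (3 * real p ^ 4 * (N + real p ^ 2)))"
    by (intro mult_left_mono add_left_mono Q) simp_all
  also have "\<dots> = real p ^ 7 * (4 * real p ^ 2 + 3 * N)"
    by (simp add: algebra_simps eval_nat_numeral)
  finally show ?thesis .
qed

text \<open>Cauchy-Schwarz in \<open>z\<close> with weights \<open>card (E z)\<close> and
  \<open>c z\<close> bounds the squared sum pointwise by \<open>N * density x t\<close>.\<close>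

lemma sum_norm_U4_le:
  "(\<Sum>t\<in>R. \<Sum>x\<in>R2. (norm (\<Sum>z\<in>R. U z x t)) ^ 4) \<le> N\<^sup>2 * (real p ^ 7 * (4 * real p ^ 2 + 3 * N))"
proof -
  have CS: "(norm (\<Sum>z\<in>R. U z x t))\<^sup>2 \<le> N * density x t" for x t
  proof -
    have "(norm (\<Sum>z\<in>R. U z x t))\<^sup>2 \<le> (\<Sum>z\<in>R. norm (U z x t))\<^sup>2"
      by (intro power_mono norm_sum) simp
    \<comment> \<open>The two weights have product \<open>1\<close> unless the slice is empty, in
      which case \<open>U z x t\<close> vanishes.\<close>
    also have "(\<Sum>z\<in>R. norm (U z x t)) = (\<Sum>z\<in>R. sqrt (card (E z)) * (sqrt (c z) * norm (U z x t)))"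
    proof (rule sum.cong [OF refl])
      fix z
      show "norm (U z x t) = sqrt (card (E z)) * (sqrt (c z) * norm (U z x t))"
      proof (cases "E z = {}")
        case True
        then show ?thesis
          by (simp add: U_def F_def)
      next
        case False
        then have "sqrt (card (E z)) * sqrt (c z) = 1"
          by (simp add: c_def real_sqrt_divide)
        then show ?thesis
          by (simp flip: mult.assoc)
      qed
    qed
    also have "\<dots>\<^sup>2 \<le> (\<Sum>z\<in>R. (sqrt (card (E z)))\<^sup>2) * (\<Sum>z\<in>R. (sqrt (c z) * norm (U z x t))\<^sup>2)"
      by (rule Cauchy_Schwarz_ineq_sum)
    also have "\<dots> = N * density x t"
      by (simp add: N_def density_def power_mult_distrib)
    finally show ?thesis .
  qed
  have "(norm (\<Sum>z\<in>R. U z x t)) ^ 4 \<le> N\<^sup>2 * (density x t)\<^sup>2" for x t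
  proof -
    have "((norm (\<Sum>z\<in>R. U z x t))\<^sup>2)\<^sup>2 \<le> (N * density x t)\<^sup>2"
      by (intro power_mono CS) simp
    then show ?thesis
      by (simp add: power_mult_distrib flip: power_mult)
  qed
  then have "(\<Sum>t\<in>R. \<Sum>x\<in>R2. (norm (\<Sum>z\<in>R. U z x t)) ^ 4) \<le> (\<Sum>t\<in>R. \<Sum>x\<in>R2. N\<^sup>2 * (density x t)\<^sup>2)"
    by (intro sum_mono)
  also have "\<dots> \<le> N\<^sup>2 * (real p ^ 7 * (4 * real p ^ 2 + 3 * N))"
    unfolding sum_distrib_left [symmetric] by (intro mult_left_mono sum_density_le) simp
  finally show ?thesis .
qed

end

section \<open>Level sets of the extension operator\<close>

context odd_paraboloid
begin

definition ext :: "(int \<times> int \<Rightarrow> complex) \<Rightarrow> int \<times> int \<Rightarrow> int \<Rightarrow> complex" where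
  "ext \<phi> x t = (\<Sum>\<xi>\<in>R2. \<phi> \<xi> * e (ip x \<xi> + t * ip \<xi> \<xi>)) / of_nat p ^ 2"

definition mass :: "(int \<times> int \<Rightarrow> complex) \<Rightarrow> real" where
  "mass \<phi> = (\<Sum>\<xi>\<in>R2. (norm (\<phi> \<xi>))\<^sup>2) / real p ^ 2"

lemma mass_nonneg: "mass \<phi> \<ge> 0"
  by (simp add: mass_def sum_nonneg)

lemma sum_norm_eq_mass: "(\<Sum>\<xi>\<in>R2. (norm (\<phi> \<xi>))\<^sup>2) = real p ^ 2 * mass \<phi>"
  by (simp add: mass_def)

text \<open>Cauchy-Schwarz, as the surface measure has total mass one.\<close>

lemma norm_ext_le: "(norm (ext \<phi> x t))\<^sup>2 \<le> mass \<phi>"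
proof -
  have "(norm (\<Sum>\<xi>\<in>R2. \<phi> \<xi> * e (ip x \<xi> + t * ip \<xi> \<xi>)))\<^sup>2 \<le>
      card R2 * (\<Sum>\<xi>\<in>R2. (norm (\<phi> \<xi> * e (ip x \<xi> + t * ip \<xi> \<xi>)))\<^sup>2)"
    by (rule norm_sum_squared_le)
  also have "\<dots> = real p ^ 2 * (real p ^ 2 * mass \<phi>)"
  proof -
    have "real (card R2) = real p ^ 2"
      by (simp add: card_cartesian_product power2_eq_square)
    then show ?thesis
      by (simp only: norm_mult norm_e mult_1_right sum_norm_eq_mass)
  qed
  finally show ?thesis
    using p_pos by (simp add: ext_def norm_divide norm_power power_divide field_simps flip: power_mult power_add)
qed

text \<open>Conservation of mass: Plancherel in \<open>x\<close> gives \<open>mass \<phi>\<close> at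
  each of the \<open>p\<close> times.\<close>

lemma sum_norm_ext: "(\<Sum>t\<in>R. \<Sum>x\<in>R2. (norm (ext \<phi> x t))\<^sup>2) = p * mass \<phi>"
proof -
  have "(\<Sum>x\<in>R2. (norm (ext \<phi> x t))\<^sup>2) = mass \<phi>" for t
  proof -
    have "(\<Sum>x\<in>R2. (norm (\<Sum>\<xi>\<in>R2. \<phi> \<xi> * e (t * ip \<xi> \<xi>) * e (ip x \<xi>)))\<^sup>2) =
        real p ^ 2 * (\<Sum>\<xi>\<in>R2. (norm (\<phi> \<xi> * e (t * ip \<xi> \<xi>)))\<^sup>2)"
      by (rule sum_norm_parseval) (simp, rule orth_ip)
    also have "\<dots> = real p ^ 2 * (real p ^ 2 * mass \<phi>)"
      by (simp add: norm_mult sum_norm_eq_mass)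
    also have "\<dots> = real p ^ 4 * mass \<phi>"
      by (simp add: eval_nat_numeral)
    finally show ?thesis
      by (simp add: ext_def e_add mult_ac norm_divide norm_power power_divide
          sum_divide_distrib [symmetric] flip: power_mult)
  qed
  then show ?thesis
    by simp
qed

text \<open>Squaring and shifting makes the phase linear in \<open>u\<close> with frequency
  \<open>2 * (t * s)\<close>. As \<open>p\<close> is odd and \<open>t\<close> a unit, only
  \<open>s = 0\<close> survives.\<close>

lemma norm_gauss_sum:
  assumes "\<not> int p dvd t"
  shows "(norm (\<Sum>s\<in>R. e (s * a + t * s\<^sup>2)))\<^sup>2 = p"
proof -
  define h where "h s = e (s * a + t * s\<^sup>2)" for s
  have h: "h (s mod int p) = h s" for s
    unfolding h_def power2_eq_square by (intro e_cong mod_add_cong mod_mult_cong) simp_all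
  have "of_real ((norm (\<Sum>s\<in>R. h s))\<^sup>2) = (\<Sum>s\<in>R. h s) * (\<Sum>u\<in>R. cnj (h u))"
    by (simp only: complex_norm_square cnj_sum)
  also have "\<dots> = (\<Sum>u\<in>R. (\<Sum>s\<in>R. h (s + u)) * cnj (h u))"
    by (simp only: sum_R_shift [of h, OF h] sum_distrib_left)
  also have "\<dots> = (\<Sum>s\<in>R. \<Sum>u\<in>R. h (s + u) * cnj (h u))"
    unfolding sum_distrib_right by (rule sum.swap)
  also have "\<dots> = (\<Sum>s\<in>R. h s * (\<Sum>u\<in>R. e (u * (2 * (t * s)))))"
  proof -
    have "h (s + u) * cnj (h u) = h s * e (u * (2 * (t * s)))" for s u
      unfolding h_def e_add [symmetric] e_diff [symmetric]
      by (rule arg_cong [of _ _ e]) (simp add: power2_eq_square algebra_simps)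
    then show ?thesis
      by (simp add: sum_distrib_left)
  qed
  also have "\<dots> = (\<Sum>s\<in>R. if s = 0 then of_nat p else 0)"
  proof (rule sum.cong [OF refl])
    fix s assume "s \<in> R"
    then have "s = 0" if "int p dvd 2 * (t * s)"
      using that [unfolded two_dvd_cancel, THEN prime_dvd_multE, OF assms] R_eqI [of s 0] by simp
    then have "int p dvd 2 * (t * s) \<longleftrightarrow> s = 0"
      by auto
    then show "h s * (\<Sum>u\<in>R. e (u * (2 * (t * s)))) = (if s = 0 then of_nat p else 0)"
      by (simp add: sum_e h_def)
  qed
  also have "\<dots> = of_real p"
    by simp
  finally show ?thesis
    unfolding of_real_eq_iff h_def .
qed

lemma norm_kernel_le:
  assumes "\<not> int p dvd t"
  shows "norm (\<Sum>\<xi>\<in>R2. e (ip v \<xi> + t * ip \<xi> \<xi>)) \<le> p"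
proof -
  define G where "G a = (\<Sum>s\<in>R. e (s * a + t * s\<^sup>2))" for a
  have "(\<Sum>\<xi>\<in>R2. e (ip v \<xi> + t * ip \<xi> \<xi>)) = G (fst v) * G (snd v)"
    by (simp add: G_def sum_product sum.cartesian_product ip_def case_prod_beta e_add [symmetric]
        power2_eq_square algebra_simps)
  moreover have "norm (G a) = sqrt p" for a
    using norm_gauss_sum [OF assms, of a] real_sqrt_unique [of "norm (G a)" p] by (simp add: G_def)
  ultimately show ?thesis
    by (simp add: norm_mult)
qed

end

section \<open>The energy of the slices and duality\<close>

context slices
begin

definition Ft :: "int \<times> int \<Rightarrow> complex" where
  "Ft \<xi> = (\<Sum>z\<in>R. F z \<xi>)"

text \<open>Equals \<open>real p ^ 2 * mass Ft\<close>.\<close>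

definition energy :: real where
  "energy = (\<Sum>\<xi>\<in>R2. (norm (Ft \<xi>))\<^sup>2)"

lemma cnj_Ft: "cnj (Ft \<xi>) = (\<Sum>z\<in>R. \<Sum>y\<in>E z. cnj (g z y) * e (ip y \<xi> + z * ip \<xi> \<xi>))"
  by (simp only: Ft_def F_def cnj_sum complex_cnj_mult e_minus complex_cnj_cnj)

text \<open>Restriction to the paraboloid and extension are adjoint; the inner sums on the right are
  \<open>p ^ 2 * ext \<phi> y z\<close>.\<close>

lemma pairing:
  "(\<Sum>\<xi>\<in>R2. \<phi> \<xi> * cnj (Ft \<xi>)) =
    (\<Sum>z\<in>R. \<Sum>y\<in>E z. cnj (g z y) * (\<Sum>\<xi>\<in>R2. \<phi> \<xi> * e (ip y \<xi> + z * ip \<xi> \<xi>)))"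
proof -
  have "(\<Sum>\<xi>\<in>R2. \<phi> \<xi> * cnj (Ft \<xi>)) =
      (\<Sum>\<xi>\<in>R2. \<Sum>z\<in>R. \<Sum>y\<in>E z. cnj (g z y) * (\<phi> \<xi> * e (ip y \<xi> + z * ip \<xi> \<xi>)))"
    by (simp only: cnj_Ft sum_distrib_left mult.left_commute)
  also have "\<dots> = (\<Sum>z\<in>R. \<Sum>y\<in>E z. \<Sum>\<xi>\<in>R2. cnj (g z y) * (\<phi> \<xi> * e (ip y \<xi> + z * ip \<xi> \<xi>)))"
    by (subst sum.swap) (intro sum.cong refl sum.swap)
  finally show ?thesis
    by (simp only: sum_distrib_left)
qed

lemma energy_eq:
  "of_real energy = (\<Sum>z\<in>R. \<Sum>y\<in>E z. cnj (g z y) * (\<Sum>\<xi>\<in>R2. Ft \<xi> * e (ip y \<xi> + z * ip \<xi> \<xi>)))"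
  unfolding energy_def of_real_sum complex_norm_square by (rule pairing)

definition Ut :: "int \<times> int \<Rightarrow> int \<Rightarrow> complex" where
  "Ut x t = (\<Sum>z\<in>R. U z x t)"

lemma Ut_eq: "Ut x t = (\<Sum>\<xi>\<in>R2. Ft \<xi> * e (ip x \<xi> + t * ip \<xi> \<xi>))"
  unfolding Ut_def U_def Ft_def sum_distrib_right by (rule sum.swap)

lemma energy_nonneg: "energy \<ge> 0"
  by (simp add: energy_def sum_nonneg)

lemma energy_le_sum: "energy \<le> (\<Sum>z\<in>R. \<Sum>y\<in>E z. norm (Ut y z))"
proof -
  have "energy = norm (complex_of_real energy)"
    using energy_nonneg by simp
  also have "\<dots> \<le> (\<Sum>z\<in>R. \<Sum>y\<in>E z. norm (cnj (g z y) * Ut y z))"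
    unfolding energy_eq Ut_eq [symmetric] by (intro sum_norm_le order.refl)
  also have "\<dots> = (\<Sum>z\<in>R. \<Sum>y\<in>E z. norm (Ut y z))"
    by (intro sum.cong refl) (simp add: norm_mult norm_g)
  finally show ?thesis .
qed

text \<open>Two applications of Cauchy-Schwarz pass from the first to the fourth moment over the
  \<open>N\<close> points at the cost of \<open>N ^ 3\<close>; the fourth moment over all of
  space-time supplies the remaining \<open>N ^ 2\<close>.\<close>

lemma energy_4: "energy ^ 4 \<le> N ^ 5 * (real p ^ 7 * (4 * real p ^ 2 + 3 * N))"
proof -
  define S where "S = Sigma R E"
  have S: "finite S" "real (card S) = N"
    by (simp_all add: S_def N_def card_SigmaI)
  define u where "u x = norm (Ut (snd x) (fst x))" for x
  have "energy \<le> (\<Sum>x\<in>S. u x)"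
    using energy_le_sum by (simp add: S_def u_def sum.Sigma case_prod_beta)
  then have "energy ^ 4 \<le> (\<Sum>x\<in>S. u x) ^ 4"
    using energy_nonneg by (rule power_mono)
  also have "\<dots> = ((\<Sum>x\<in>S. u x)\<^sup>2)\<^sup>2"
    by (simp flip: power_mult)
  also have "\<dots> \<le> ((\<Sum>x\<in>S. (u x)\<^sup>2) * N)\<^sup>2"
    using sum_squared_le_sum_of_squares [of u S] S by (intro power_mono) simp_all
  also have "\<dots> = (\<Sum>x\<in>S. (u x)\<^sup>2)\<^sup>2 * N\<^sup>2"
    by (rule power_mult_distrib)
  also have "\<dots> \<le> ((\<Sum>x\<in>S. ((u x)\<^sup>2)\<^sup>2) * N) * N\<^sup>2"
    using sum_squared_le_sum_of_squares [of "\<lambda>x. (u x)\<^sup>2" S] S by (intro mult_right_mono) simp_all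
  also have "(\<Sum>x\<in>S. ((u x)\<^sup>2)\<^sup>2) \<le> (\<Sum>x\<in>R \<times> R2. (u x) ^ 4)"
    using E_subset by (simp flip: power_mult) (auto simp: S_def intro!: sum_mono2)
  also have "\<dots> = (\<Sum>t\<in>R. \<Sum>x\<in>R2. (norm (Ut x t)) ^ 4)"
    by (simp add: u_def sum.cartesian_product case_prod_beta)
  also have "\<dots> \<le> N\<^sup>2 * (real p ^ 7 * (4 * real p ^ 2 + 3 * N))"
    unfolding Ut_def by (rule sum_norm_U4_le)
  finally have "energy ^ 4 \<le> N\<^sup>2 * (real p ^ 7 * (4 * real p ^ 2 + 3 * N)) * N * N\<^sup>2"
    using N_nonneg by (simp add: mult_right_mono)
  then show ?thesis
    by (simp add: eval_nat_numeral mult_ac)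
qed

text \<open>\<open>Ut\<close> is a sum of translates of one kernel. At equal times the kernel
  vanishes except at coinciding points, where it is \<open>p ^ 2\<close>; at different times the
  Gauss sums bound it by \<open>p\<close>.\<close>

lemma norm_Ut_le:
  assumes "y \<in> R2" "z \<in> R"
  shows "norm (Ut y z) \<le> real p ^ 2 + N * p"
proof -
  have "Ut y z = (\<Sum>z'\<in>R. \<Sum>y'\<in>E z'. g z' y' * (\<Sum>\<xi>\<in>R2. e (ip (y - y') \<xi> + (z - z') * ip \<xi> \<xi>)))"
  proof -
    have "Ut y z = (\<Sum>\<xi>\<in>R2. \<Sum>z'\<in>R. \<Sum>y'\<in>E z'. g z' y' * e (ip (y - y') \<xi> + (z - z') * ip \<xi> \<xi>))"
    proof -
      have "e (- (ip y' \<xi> + z' * ip \<xi> \<xi>)) * e (ip y \<xi> + z * ip \<xi> \<xi>) = e (ip (y - y') \<xi> + (z - z') * ip \<xi> \<xi>)" for y' z' \<xi>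
        unfolding e_add [symmetric] by (rule arg_cong [of _ _ e]) (simp add: ip_def algebra_simps)
      then show ?thesis
        by (simp add: Ut_eq Ft_def F_def sum_distrib_right mult.assoc)
    qed
    also have "\<dots> = (\<Sum>z'\<in>R. \<Sum>y'\<in>E z'. \<Sum>\<xi>\<in>R2. g z' y' * e (ip (y - y') \<xi> + (z - z') * ip \<xi> \<xi>))"
      by (subst sum.swap) (intro sum.cong refl sum.swap)
    finally show ?thesis
      by (simp only: sum_distrib_left)
  qed
  also have "norm \<dots> \<le> (\<Sum>z'\<in>R. \<Sum>y'\<in>E z'. (if z' = z \<and> y' = y then real p ^ 2 else 0) + p)"
  proof (intro sum_norm_le)
    fix z' y' assume *: "z' \<in> R" "y' \<in> E z'"
    have "norm (\<Sum>\<xi>\<in>R2. e (ip (y - y') \<xi> + (z - z') * ip \<xi> \<xi>)) \<le> (if z' = z \<and> y' = y then real p ^ 2 else 0) + p"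
    proof (cases "z' = z")
      case True
      have "(\<Sum>\<xi>\<in>R2. e (ip (y - y') \<xi> + (z - z') * ip \<xi> \<xi>)) = (\<Sum>\<xi>\<in>R2. e (ip \<xi> y) * cnj (e (ip \<xi> y')))"
        unfolding e_diff [symmetric] using True by (simp add: ip_def algebra_simps)
      also have "\<dots> = (if y = y' then of_real (real p ^ 2) else 0)"
        using * assms E_subset by (intro orth_ip) auto
      finally show ?thesis
        using True by (simp add: norm_power)
    next
      case False
      then have "\<not> int p dvd z - z'"
        using R_eqI [of z z'] assms * by auto
      from norm_kernel_le [OF this, of "y - y'"] False show ?thesis
        by simp
    qed
    then show "norm (g z' y' * (\<Sum>\<xi>\<in>R2. e (ip (y - y') \<xi> + (z - z') * ip \<xi> \<xi>)))
        \<le> (if z' = z \<and> y' = y then real p ^ 2 else 0) + p"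
      using * by (simp add: norm_mult norm_g)
  qed
  also have "\<dots> \<le> real p ^ 2 + N * p"
  proof -
    have "(\<Sum>y'\<in>E z'. if z' = z \<and> y' = y then real p ^ 2 else 0) \<le> (if z' = z then real p ^ 2 else 0)" for z'
      by (cases "z' = z") (simp_all add: sum.delta)
    then have "(\<Sum>z'\<in>R. \<Sum>y'\<in>E z'. if z' = z \<and> y' = y then real p ^ 2 else 0) \<le> (\<Sum>z'\<in>R. if z' = z then real p ^ 2 else 0)"
      by (rule sum_mono)
    also have "\<dots> \<le> real p ^ 2"
      by (simp add: sum.delta)
    finally show ?thesis
      by (simp add: sum.distrib N_def sum_distrib_right)
  qed
  finally show ?thesis .
qed

lemma energy_le: "energy \<le> N * (real p ^ 2 + N * p)"
proof -
  have "energy \<le> (\<Sum>z\<in>R. \<Sum>y\<in>E z. norm (Ut y z))"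
    by (rule energy_le_sum)
  also have "\<dots> \<le> (\<Sum>z\<in>R. \<Sum>y\<in>E z. real p ^ 2 + N * p)"
    using E_subset by (intro sum_mono norm_Ut_le) auto
  also have "\<dots> = N * (real p ^ 2 + N * p)"
    by (simp add: N_def sum_distrib_right)
  finally show ?thesis .
qed

text \<open>The first assumption aligns the phases, so the sum of the values
  \<open>norm (ext \<phi> y z)\<close> is a pairing of \<open>\<phi>\<close> with \<open>Ft\<close>,
  to which Cauchy-Schwarz in \<open>\<xi>\<close> applies.\<close>

lemma duality:
  assumes "\<And>z y. z \<in> R \<Longrightarrow> y \<in> E z \<Longrightarrow> cnj (g z y) * ext \<phi> y z = of_real (norm (ext \<phi> y z))"
    and "\<And>z y. z \<in> R \<Longrightarrow> y \<in> E z \<Longrightarrow> \<delta> \<le> norm (ext \<phi> y z)"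
    and "\<delta> \<ge> 0"
  shows "(\<delta> * N)\<^sup>2 * real p ^ 2 \<le> mass \<phi> * energy"
proof -
  have "\<delta> * N \<le> (\<Sum>z\<in>R. \<Sum>y\<in>E z. norm (ext \<phi> y z))"
  proof -
    have "\<delta> * N = (\<Sum>z\<in>R. \<Sum>y\<in>E z. \<delta>)"
      by (simp add: N_def sum_distrib_left mult.commute)
    then show ?thesis
      using assms(2) by (simp only:) (intro sum_mono)
  qed
  also have "\<dots> = norm (complex_of_real (\<Sum>z\<in>R. \<Sum>y\<in>E z. norm (ext \<phi> y z)))"
    unfolding norm_of_real by (simp add: sum_nonneg)
  also have "complex_of_real (\<Sum>z\<in>R. \<Sum>y\<in>E z. norm (ext \<phi> y z)) = (\<Sum>z\<in>R. \<Sum>y\<in>E z. cnj (g z y) * ext \<phi> y z)"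
    unfolding of_real_sum by (intro sum.cong refl) (simp add: assms(1))
  also have "\<dots> = (\<Sum>\<xi>\<in>R2. \<phi> \<xi> * cnj (Ft \<xi>)) / of_nat p ^ 2"
    by (simp only: pairing ext_def times_divide_eq_right sum_divide_distrib [symmetric])
  finally have "\<delta> * N * real p ^ 2 \<le> norm (\<Sum>\<xi>\<in>R2. \<phi> \<xi> * cnj (Ft \<xi>))"
    by (simp add: norm_divide norm_power field_simps)
  then have "(\<delta> * N * real p ^ 2)\<^sup>2 \<le> (norm (\<Sum>\<xi>\<in>R2. \<phi> \<xi> * cnj (Ft \<xi>)))\<^sup>2"
    using assms(3) N_nonneg by (intro power_mono) simp_all
  also have "\<dots> \<le> (\<Sum>\<xi>\<in>R2. norm (\<phi> \<xi>) * norm (Ft \<xi>))\<^sup>2"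
    by (intro power_mono order.trans [OF norm_sum]) (simp_all add: norm_mult)
  also have "\<dots> \<le> (\<Sum>\<xi>\<in>R2. (norm (\<phi> \<xi>))\<^sup>2) * (\<Sum>\<xi>\<in>R2. (norm (Ft \<xi>))\<^sup>2)"
    by (rule Cauchy_Schwarz_ineq_sum)
  also have "\<dots> = real p ^ 2 * (mass \<phi> * energy)"
    by (simp add: sum_norm_eq_mass energy_def)
  finally have "real p ^ 2 * ((\<delta> * N)\<^sup>2 * real p ^ 2) \<le> real p ^ 2 * (mass \<phi> * energy)"
    by (simp add: power_mult_distrib power2_eq_square mult_ac)
  then show ?thesis
    using p_pos by simp
qed

end

section \<open>The weak-type estimate\<close>

text \<open>Three regimes, with \<open>\<mu>\<close> a squared level and \<open>A\<close> the mass.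
  If \<open>\<mu> * p\<close> is at least \<open>2 * A\<close>, then \<open>h3\<close> yields
  \<open>\<mu> * N \<le> 2 * A\<close>, and \<open>\<mu> \<le> A\<close> finishes. Otherwise, for
  \<open>N\<close> up to the square of \<open>p\<close>, \<open>h1\<close> times
  \<open>\<mu>\<close> gives the constant \<open>7 * 2 = 14\<close>; for larger \<open>N\<close>,
  \<open>h1\<close> is multiplied by \<open>h2\<close>.\<close>

lemma level_arith:
  fixes \<mu> N A p :: real
  assumes "\<mu> \<ge> 0" "N > 0" "A \<ge> 0" "p > 0" "\<mu> \<le> A"
    and h1: "\<mu> ^ 4 * N ^ 3 * p \<le> A ^ 4 * (4 * p\<^sup>2 + 3 * N)"
    and h2: "\<mu> * N \<le> p * A"
    and h3: "\<mu> * N * p \<le> A * (p + N)"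
  shows "N ^ 3 * \<mu> ^ 5 \<le> 14 * A ^ 5"
proof (cases "\<mu> * p \<ge> 2 * A")
  case True
  have "2 * A * N \<le> \<mu> * p * N"
    using True \<open>N > 0\<close> by (intro mult_right_mono) simp_all
  then have "p * (\<mu> * N) \<le> p * (2 * A)"
    using h3 by (simp add: algebra_simps)
  then have "\<mu> * N \<le> 2 * A"
    using \<open>p > 0\<close> by simp
  then have "(\<mu> * N) ^ 3 \<le> (2 * A) ^ 3"
    using assms by (intro power_mono) simp_all
  then have "(\<mu> * N) ^ 3 * \<mu>\<^sup>2 \<le> (2 * A) ^ 3 * A\<^sup>2"
    using assms by (intro mult_mono) simp_all
  also have "\<dots> \<le> 14 * A ^ 5"
    using \<open>A \<ge> 0\<close> by (simp add: eval_nat_numeral)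
  finally show ?thesis
    by (simp add: eval_nat_numeral mult_ac)
next
  case False
  show ?thesis
  proof (cases "N \<le> p\<^sup>2")
    case True
    then have "A ^ 4 * (4 * p\<^sup>2 + 3 * N) \<le> A ^ 4 * (7 * p\<^sup>2)"
      by (intro mult_left_mono) (use \<open>A \<ge> 0\<close> in auto)
    then have "p * (\<mu> ^ 4 * N ^ 3) \<le> p * (7 * A ^ 4 * p)"
      using h1 by (simp add: power2_eq_square mult_ac)
    then have "\<mu> ^ 4 * N ^ 3 \<le> 7 * A ^ 4 * p"
      using \<open>p > 0\<close> by simp
    then have "\<mu> * (\<mu> ^ 4 * N ^ 3) \<le> \<mu> * (7 * A ^ 4 * p)"
      using \<open>\<mu> \<ge> 0\<close> by (rule mult_left_mono)
    also have "\<dots> = 7 * A ^ 4 * (\<mu> * p)"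
      by simp
    also have "\<dots> \<le> 7 * A ^ 4 * (2 * A)"
      using False \<open>A \<ge> 0\<close> by (intro mult_left_mono) simp_all
    finally show ?thesis
      by (simp add: eval_nat_numeral mult_ac)
  next
    case False
    then have "A ^ 4 * (4 * p\<^sup>2 + 3 * N) \<le> A ^ 4 * (7 * N)"
      by (intro mult_left_mono) (use \<open>A \<ge> 0\<close> in auto)
    then have "N * (\<mu> ^ 4 * N\<^sup>2 * p) \<le> N * (7 * A ^ 4)"
      using h1 by (simp add: eval_nat_numeral mult_ac)
    then have "\<mu> ^ 4 * N\<^sup>2 * p \<le> 7 * A ^ 4"
      using \<open>N > 0\<close> by simp
    then have "(\<mu> ^ 4 * N\<^sup>2 * p) * (\<mu> * N) \<le> (7 * A ^ 4) * (p * A)"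
      by (rule mult_mono) (use h2 assms in simp_all)
    then have "p * (N ^ 3 * \<mu> ^ 5) \<le> p * (7 * A ^ 5)"
      by (simp add: eval_nat_numeral mult_ac)
    then have "N ^ 3 * \<mu> ^ 5 \<le> 7 * A ^ 5"
      using \<open>p > 0\<close> by simp
    also have "\<dots> \<le> 14 * A ^ 5"
      using \<open>A \<ge> 0\<close> by simp
    finally show ?thesis .
  qed
qed

text \<open>Duality feeds \<open>level_arith\<close> with the fourth moment bound and the Gauss sum
  bound for the energy; Chebyshev's inequality and conservation of mass supply
  \<open>h2\<close>.\<close>

lemma (in odd_paraboloid) level_set_bound:
  assumes X: "X \<subseteq> R2 \<times> R" and \<delta>: "\<delta> > 0" "\<And>x t. (x, t) \<in> X \<Longrightarrow> \<delta> \<le> norm (ext \<phi> x t)"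
  shows "real (card X) ^ 3 * \<delta> ^ 10 \<le> 14 * mass \<phi> ^ 5"
proof (cases "X = {}")
  case True
  then show ?thesis
    using mass_nonneg by simp
next
  case False
  have finX: "finite X"
    using X by (rule finite_subset) simp
  define E where "E z = {y. (y, z) \<in> X}" for z
  \<comment> \<open>The phase of \<open>ext \<phi>\<close> itself serves as \<open>g\<close>; it is
    unimodular on \<open>X\<close> because the level \<open>\<delta>\<close> is positive.\<close>
  interpret S: slices p E "\<lambda>z y. sgn (ext \<phi> y z)"
  proof
    show "E z \<subseteq> R2" for z
      using X by (auto simp: E_def)
    show "y \<in> E z \<Longrightarrow> norm (sgn (ext \<phi> y z)) = 1" for y z
      using \<delta> by (fastforce simp: E_def norm_sgn)
  qed
  have N: "S.N = card X"
  proof -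
    have "X = (\<lambda>(z, y). (y, z)) ` Sigma R E"
      using X by (force simp: E_def)
    then have "card X = card (Sigma R E)"
      by (simp add: card_image inj_on_def split_beta prod_eq_iff)
    then show ?thesis
      by (simp add: S.N_def card_SigmaI)
  qed
  have dual: "(\<delta> * S.N)\<^sup>2 * real p ^ 2 \<le> mass \<phi> * S.energy"
  proof (rule S.duality)
    fix z y assume "y \<in> E z"
    then show "\<delta> \<le> norm (ext \<phi> y z)"
      using \<delta> by (simp add: E_def)
    show "cnj (sgn (ext \<phi> y z)) * ext \<phi> y z = of_real (norm (ext \<phi> y z))"
      by (simp add: sgn_eq complex_norm_square [symmetric] mult.commute power2_eq_square)
  qed (use \<delta> in simp)
  define n where "n = real (card X)"
  have n: "n > 0" "S.N = n"
    using False finX by (simp_all add: n_def N card_gt_0_iff)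
  define A where "A = mass \<phi>"
  have A: "A \<ge> 0"
    by (simp add: A_def mass_nonneg)
  have dual: "\<delta>\<^sup>2 * n\<^sup>2 * real p ^ 2 \<le> A * S.energy"
    using dual by (simp add: n A_def power_mult_distrib)
  have "n ^ 3 * (\<delta>\<^sup>2) ^ 5 \<le> 14 * A ^ 5"
  proof (rule level_arith)
    obtain x t where xt: "(x, t) \<in> X"
      using False by auto
    have "\<delta>\<^sup>2 \<le> (norm (ext \<phi> x t))\<^sup>2"
      using \<delta> xt by (intro power_mono) auto
    also have "\<dots> \<le> A"
      unfolding A_def by (rule norm_ext_le)
    finally show "\<delta>\<^sup>2 \<le> A" .
    have "(\<delta>\<^sup>2 * n\<^sup>2 * real p ^ 2) ^ 4 \<le> (A * S.energy) ^ 4"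
      using dual by (rule power_mono) simp
    also have "\<dots> \<le> A ^ 4 * (n ^ 5 * (real p ^ 7 * (4 * real p ^ 2 + 3 * n)))"
      using S.energy_4 by (simp add: power_mult_distrib n mult_left_mono)
    \<comment> \<open>The fourth power of the duality bound carries \<open>n ^ 8 * p ^ 8\<close> on
      the left; the factor \<open>n ^ 5 * p ^ 7\<close> cancels against
      \<open>S.energy_4\<close>.\<close>
    finally have "(n ^ 5 * real p ^ 7) * ((\<delta>\<^sup>2) ^ 4 * n ^ 3 * p) \<le> (n ^ 5 * real p ^ 7) * (A ^ 4 * (4 * (real p)\<^sup>2 + 3 * n))"
      by (simp add: eval_nat_numeral mult_ac)
    then show "(\<delta>\<^sup>2) ^ 4 * n ^ 3 * p \<le> A ^ 4 * (4 * (real p)\<^sup>2 + 3 * n)"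
      using n p_pos by (subst (asm) mult_le_cancel_left_pos) simp_all
    have "\<delta>\<^sup>2 * n = (\<Sum>(x, t)\<in>X. \<delta>\<^sup>2)"
      by (simp add: n_def)
    also have "\<dots> \<le> (\<Sum>(x, t)\<in>X. (norm (ext \<phi> x t))\<^sup>2)"
      using \<delta> by (intro sum_mono) (auto intro!: power_mono)
    also have "\<dots> \<le> (\<Sum>(x, t)\<in>R2 \<times> R. (norm (ext \<phi> x t))\<^sup>2)"
      using X by (intro sum_mono2) auto
    also have "\<dots> = p * A"
      unfolding sum.cartesian_product [symmetric] A_def by (subst sum.swap) (rule sum_norm_ext)
    finally show "\<delta>\<^sup>2 * n \<le> p * A" .
    have "\<delta>\<^sup>2 * n\<^sup>2 * real p ^ 2 \<le> A * (n * (real p ^ 2 + n * p))"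
      using S.energy_le A by (intro order.trans [OF dual] mult_left_mono) (simp_all add: n)
    then have "(n * p) * (\<delta>\<^sup>2 * n * p) \<le> (n * p) * (A * (p + n))"
      by (simp add: power2_eq_square algebra_simps)
    then show "\<delta>\<^sup>2 * n * p \<le> A * (p + n)"
      using n p_pos by simp
  qed (use n A p_pos in auto)
  then show ?thesis
    by (simp add: n_def A_def flip: power_mult)
qed

section \<open>From level sets to the norm\<close>

text \<open>A discrete decreasing rearrangement: a minimal element has rank \<open>card X\<close>,
  so it is charged to the last term of the sum, and induction handles the rest.\<close>

lemma sum_le_sum_by_rank:
  fixes h :: "'a \<Rightarrow> real" and b :: "nat \<Rightarrow> real"
  assumes "finite X"
    and "\<And>i j. 1 \<le> i \<Longrightarrow> i \<le> j \<Longrightarrow> b j \<le> b i"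
    and "\<And>x. x \<in> X \<Longrightarrow> h x \<le> b (card {y \<in> X. h x \<le> h y})"
  shows "(\<Sum>x\<in>X. h x) \<le> (\<Sum>j = 1..card X. b j)"
  using assms(1,3)
proof (induction "card X" arbitrary: X)
  case 0
  then show ?case
    by simp
next
  case (Suc n)
  then have "X \<noteq> {}"
    by auto
  then obtain x where x: "x \<in> X" "\<And>y. y \<in> X \<Longrightarrow> h x \<le> h y"
    using ex_min_if_finite [of "h ` X"] Suc.prems(1) by (metis arg_min_if_finite linorder_not_less)
  then have "{y \<in> X. h x \<le> h y} = X"
    by auto
  with Suc.prems(2) [OF x(1)] have hx: "h x \<le> b (Suc n)"
    by (simp add: Suc.hyps(2))
  have card: "card (X - {x}) = n"
    using x(1) Suc.hyps(2) Suc.prems(1) by (simp add: card_Diff_singleton)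
  have "(\<Sum>y\<in>X - {x}. h y) \<le> (\<Sum>j = 1..card (X - {x}). b j)"
  proof (rule Suc.hyps(1))
    fix y assume y: "y \<in> X - {x}"
    have "h y \<le> b (card {z \<in> X. h y \<le> h z})"
      using y Suc.prems(2) by blast
    \<comment> \<open>Deleting the minimal \<open>x\<close> lowers the rank of \<open>y\<close> only
      in case of a tie, and then \<open>b\<close> can only grow; the rank stays at least
      \<open>1\<close> because \<open>y\<close> counts itself.\<close>
    also have "\<dots> \<le> b (card {z \<in> X - {x}. h y \<le> h z})"
    proof (rule assms(2))
      have "y \<in> {z \<in> X - {x}. h y \<le> h z}"
        using y by simp
      then show "1 \<le> card {z \<in> X - {x}. h y \<le> h z}"
        using Suc.prems(1) by (metis (no_types, lifting) Suc_leI card_gt_0_iff One_nat_def empty_iff finite_Diff finite_subset mem_Collect_eq subsetI)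
      show "card {z \<in> X - {x}. h y \<le> h z} \<le> card {z \<in> X. h y \<le> h z}"
        using Suc.prems(1) by (intro card_mono) auto
    qed
    finally show "h y \<le> b (card {z \<in> X - {x}. h y \<le> h z})" .
  qed (use card Suc.prems(1) in auto)
  then have "(\<Sum>y\<in>X. h y) \<le> b (Suc n) + (\<Sum>j = 1..n. b j)"
    using hx sum.remove [OF Suc.prems(1) x(1), of h] card by simp
  then show ?case
    by (simp add: Suc.hyps(2) [symmetric])
qed

section \<open>Transfer to the norms over the residue ring\<close>

context odd_paraboloid
begin

definition lift :: "int \<times> int \<Rightarrow> int \<times> int \<times> int" where
  "lift \<xi> = (fst \<xi>, snd \<xi>, ip \<xi> \<xi> mod int p)"

lemma carrier_Fp: "carrier (Fp p) = R"
  by (auto simp: residue_ring_def)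

lemma inj_lift: "inj_on lift R2"
  by (auto simp: lift_def inj_on_def)

lemma paraboloid_eq: "paraboloid p = lift ` R2"
proof -
  have "dot2 p (a, b) (a, b) = ip (a, b) (a, b) mod int p" for a b
    by (simp add: residue_ring_def ip_def mod_simps)
  then show ?thesis
    unfolding paraboloid_def carrier_Fp by (force simp: lift_def image_iff)
qed

lemma extension_eq: "extension p f (x, y, t) = ext (f \<circ> lift) (x, y) t"
proof -
  have "e (dot3 p (x, y, t) (lift \<xi>)) = e (ip (x, y) \<xi> + t * ip \<xi> \<xi>)" for \<xi>
    by (rule e_cong) (simp add: lift_def residue_ring_def ip_def mod_simps)
  then show ?thesis
    by (simp add: extension_def ext_def paraboloid_eq sum.reindex [OF inj_lift])
qed

lemma norm_L2_eq: "norm_L2_paraboloid p f = sqrt (mass (f \<circ> lift))"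
  by (simp add: norm_L2_paraboloid_def mass_def paraboloid_eq sum.reindex [OF inj_lift])

text \<open>By the weak-type bound the value of rank \<open>j\<close> among the \<open>r\<close>-th
  powers is at most \<open>B * j powr (- s)\<close>. Since \<open>s > 1\<close> exactly when
  \<open>r > 10 / 3\<close>, the series converges, with a sum independent of
  \<open>p\<close>.\<close>

lemma norm_Fp3_extension_le:
  assumes r: "r > 10 / 3"
  shows "norm_Fp3 p r (extension p f) \<le>
    14 powr (1 / 10) * (\<Sum>j. real j powr (- (3 * r / 10))) powr (1 / r) * norm_L2_paraboloid p f"
proof -
  define s where "s = 3 * r / 10"
  define A where "A = mass (f \<circ> lift)"
  define B where "B = (14 * A ^ 5) powr (r / 10)"
  \<comment> \<open>The term \<open>j = 0\<close> is \<open>0\<close>, since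
    \<open>0 powr (- s) = 0\<close>.\<close>
  define Z where "Z = (\<Sum>j. real j powr (- s))"
  define u where "u x = norm (extension p f x)" for x
  have A: "A \<ge> 0"
    by (simp add: A_def mass_nonneg)
  have Fp3: "Fp3 p = R \<times> R \<times> R"
    by (simp add: Fp3_def carrier_Fp)
  have level: "u x powr r \<le> B * real (card {y \<in> Fp3 p. u x powr r \<le> u y powr r}) powr (- s)" if x: "x \<in> Fp3 p" for x
  proof (cases "u x = 0")
    case True
    then show ?thesis
      by (simp add: B_def)
  next
    case False
    then have u: "u x > 0"
      by (simp add: u_def)
    define L where "L = {y \<in> Fp3 p. u x powr r \<le> u y powr r}"
    define n where "n = real (card L)"
    have "u x powr r \<le> u y powr r \<longleftrightarrow> u x \<le> u y" for y
      using powr_less_mono2 [of r "u y" "u x"] powr_mono2 [of r "u x" "u y"] r u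
      by (force simp: u_def)
    then have L: "L = {y \<in> Fp3 p. u x \<le> u y}"
      by (simp add: L_def)
    have "finite L"
      by (simp add: L_def Fp3)
    moreover have "x \<in> L"
      using x by (simp add: L)
    ultimately have n: "n > 0"
      by (auto simp: n_def card_gt_0_iff)
    define X where "X = (\<lambda>(a, b, t). ((a, b), t)) ` L"
    have "real (card X) ^ 3 * u x ^ 10 \<le> 14 * mass (f \<circ> lift) ^ 5"
    proof (rule level_set_bound)
      show "X \<subseteq> R2 \<times> R"
        by (auto simp: X_def L Fp3)
      show "\<And>y t. (y, t) \<in> X \<Longrightarrow> u x \<le> norm (ext (f \<circ> lift) y t)"
        by (auto simp: X_def L u_def extension_eq)
    qed (rule u)
    moreover have "card X = card L"
      unfolding X_def by (rule card_image) (auto simp: inj_on_def)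
    ultimately have "n ^ 3 * u x ^ 10 \<le> 14 * A ^ 5"
      by (simp add: n_def A_def)
    \<comment> \<open>The exponent \<open>r / 10\<close> turns \<open>u x ^ 10\<close> into
      \<open>u x powr r\<close> and \<open>n ^ 3\<close> into \<open>n powr s\<close>.\<close>
    then have "(n ^ 3 * u x ^ 10) powr (r / 10) \<le> B"
      unfolding B_def using r n u by (intro powr_mono2) simp_all
    also have "(n ^ 3 * u x ^ 10) powr (r / 10) = n powr s * u x powr r"
      using n u by (simp add: powr_mult powr_powr s_def flip: powr_numeral)
    finally show ?thesis
      using n by (simp add: powr_minus field_simps n_def [symmetric] flip: L_def)
  qed
  have "(\<Sum>x\<in>Fp3 p. u x powr r) \<le> (\<Sum>j = 1..card (Fp3 p). B * real j powr (- s))"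
  proof (rule sum_le_sum_by_rank [where b = "\<lambda>j. B * real j powr (- s)"])
    show "finite (Fp3 p)"
      by (simp add: Fp3)
    show "B * real j powr (- s) \<le> B * real i powr (- s)" if "1 \<le> i" "i \<le> j" for i j
      using that r by (intro mult_left_mono powr_mono2') (auto simp: s_def B_def)
  qed (rule level)
  also have "\<dots> \<le> B * Z"
  proof -
    have "summable (\<lambda>j. real j powr (- s))"
      using r by (subst summable_real_powr_iff) (simp add: s_def)
    then have "(\<Sum>j = 1..card (Fp3 p). real j powr (- s)) \<le> Z"
      unfolding Z_def by (intro sum_le_suminf) auto
    then show ?thesis
      by (simp add: sum_distrib_left [symmetric] B_def mult_left_mono)
  qed
  finally have "norm_Fp3 p r (extension p f) \<le> (B * Z) powr (1 / r)"
    unfolding norm_Fp3_def u_def using r by (intro powr_mono2) (auto intro: sum_nonneg)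
  also have "\<dots> = B powr (1 / r) * Z powr (1 / r)"
    by (rule powr_mult)
  also have "B powr (1 / r) = (14 * A ^ 5) powr (1 / 10)"
    using r by (simp add: B_def powr_powr)
  also have "\<dots> = 14 powr (1 / 10) * sqrt A"
  proof (cases "A = 0")
    case False
    with A have "(A ^ 5) powr (1 / 10) = sqrt A"
      by (simp add: powr_powr powr_half_sqrt flip: powr_numeral)
    then show ?thesis
      using A by (simp add: powr_mult)
  qed simp
  finally show ?thesis
    by (simp add: norm_L2_eq A_def Z_def s_def mult_ac)
qed

end

theorem corollary4:
  fixes r :: real
  assumes "r > 10 / 3"
  shows "\<exists>C>0. \<forall>p :: nat. prime p \<longrightarrow> \<not> QuadRes (int p) (- 1) \<longrightarrow>
           (\<forall>f :: int \<times> int \<times> int \<Rightarrow> complex.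
              norm_Fp3 p r (extension p f) \<le> C * norm_L2_paraboloid p f)"
proof (intro exI conjI allI impI)
  \<comment> \<open>The constant involves only \<open>r\<close>. Adding \<open>1\<close> to it makes
    it strictly positive without a lower bound for the series.\<close>
  let ?C = "14 powr (1 / 10) * (\<Sum>j. real j powr (- (3 * r / 10))) powr (1 / r)"
  show "?C + 1 > 0"
    by (simp add: add_nonneg_pos)
  fix p :: nat and f :: "int \<times> int \<times> int \<Rightarrow> complex"
  assume "prime p" "\<not> QuadRes (int p) (- 1)"
  then interpret odd_paraboloid p
    by unfold_locales
  have "norm_Fp3 p r (extension p f) \<le> ?C * norm_L2_paraboloid p f"
    using assms by (rule norm_Fp3_extension_le)
  also have "\<dots> \<le> (?C + 1) * norm_L2_paraboloid p f"
    by (intro mult_right_mono) (simp_all add: norm_L2_eq mass_nonneg)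
  finally show "norm_Fp3 p r (extension p f) \<le> (?C + 1) * norm_L2_paraboloid p f" .
qed

end
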